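(* Let $\mu = \mathcal{N}(\bar m,\mathcal{C})$ be a Gaussian measure on $\mathscr{H}$, and let $\Theta : (\mathscr{H},\mathscr{B}(\mathscr{H}),\mu)\to(\mathbb{R},\mathscr{B}(\mathbb{R}))$ be a function that is twice differentiable at $\bar m\in\mathscr{H}$, with gradient $\Theta_m(\bar m)\in\mathscr{H}$ and Hessian $\Theta_{mm}(\bar m)\in\mathcal{L}_{\mathrm{sym}}(\mathscr{H})$. Let $\Theta_{\mathrm{quad}} : (\mathscr{H},\mathscr{B}(\mathscr{H}),\mu)\to(\mathbb{R},\mathscr{B}(\mathbb{R}))$ be defined by $$\Theta_{\mathrm{quad}}(m) = \Theta(\bar m) + \langle \Theta_m(\bar m), m-\bar m\rangle + \tfrac12 \langle \Theta_{mm}(\bar m)(m-\bar m), m-\bar m\rangle .$$ Then $$\mathrm{E}\{\Theta_{\mathrm{quad}}\} = \Theta(\bar m) + \tfrac12 \mathrm{Tr}\big[\mathcal{C}^{1/2}\Theta_{mm}(\bar m)\mathcal{C}^{1/2}\big],$$ $$\mathrm{Var}\{\Theta_{\mathrm{quad}}\} = \langle \Theta_m(\bar m), \mathcal{C}[\Theta_m(\bar m)]\rangle + \tfrac12 \mathrm{Tr}\big[(\mathcal{C}^{1/2}\Theta_{mm}(\bar m)\mathcal{C}^{1/2})^2\big].$$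
   Context: $\mathscr{H}$ is an infinite-dimensional real separable Hilbert space with inner product $\langle\cdot,\cdot\rangle$; $\mathscr{B}(\cdot)$ denotes the Borel sigma-algebra. $\mathcal{N}(\bar m,\mathcal{C})$ is the Gaussian measure on $\mathscr{H}$ with mean $\bar m$ and covariance operator $\mathcal{C}$, where $\mathcal{C}$ is a positive, self-adjoint, trace-class operator on $\mathscr{H}$. $\mathcal{L}_{\mathrm{sym}}(\mathscr{H})$ is the space of bounded self-adjoint linear operators on $\mathscr{H}$. Differentiability is in the Fréchet sense, and $\Theta_m(\bar m)$, $\Theta_{mm}(\bar m)$ are the Riesz representers of the first and second derivatives of $\Theta$ at $\bar m$. $\mathrm{Tr}$ denotes the trace of an operator on $\mathscr{H}$. Expectation and variance are with respect to $\mu$: $\mathrm{E}\{\phi\} = \int_{\mathscr{H}}\phi(m)\,\mu(dm)$ and $\mathrm{Var}\{\phi\} = \mathrm{E}\{(\phi - \mathrm{E}\{\phi\})^2\}$. *)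

theory Defs
  imports "HOL-Probability.Probability"
begin

(* Bounded operators on the real Hilbert space 'h are elements of type 'h \<Rightarrow>\<^sub>L 'h.  A real separable
   Hilbert space is a type of sort {real_inner, polish_space}: for metric spaces, second
   countability is separability. *)

definition L_sym :: "('h::real_inner \<Rightarrow>\<^sub>L 'h) set" where
  "L_sym = {A :: 'h \<Rightarrow>\<^sub>L 'h. \<forall>x y. A x \<bullet> y = x \<bullet> A y}"

(* Positivity is non-strict, so degenerate covariance operators are included. *)
definition positive_op :: "('h::real_inner \<Rightarrow>\<^sub>L 'h) \<Rightarrow> bool" where
  "positive_op A \<longleftrightarrow> (\<forall>x. 0 \<le> A x \<bullet> x)"

definition op_sqrt :: "('h::real_inner \<Rightarrow>\<^sub>L 'h) \<Rightarrow> ('h \<Rightarrow>\<^sub>L 'h)" where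
  "op_sqrt A = (THE S. S \<in> L_sym \<and> positive_op S \<and> S o\<^sub>L S = A)"

(* Nuclear representation; on a Hilbert space the nuclear operators are the trace-class ones. *)
definition trace_class :: "('h::real_inner \<Rightarrow>\<^sub>L 'h) \<Rightarrow> bool" where
  "trace_class A \<longleftrightarrow> (\<exists>a b :: nat \<Rightarrow> 'h. summable (\<lambda>j. norm (a j) * norm (b j)) \<and>
     (\<forall>x. (\<lambda>j. (a j \<bullet> x) *\<^sub>R b j) sums A x))"

definition orthonormal_basis :: "'h::real_inner set \<Rightarrow> bool" where
  "orthonormal_basis B \<longleftrightarrow>
     pairwise orthogonal B \<and> (\<forall>e\<in>B. norm e = 1) \<and> closure (span B) = UNIV"

(* The common value of the sum over all orthonormal bases; meaningful for trace-class operators. *)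
definition op_trace :: "('h::real_inner \<Rightarrow>\<^sub>L 'h) \<Rightarrow> real" where
  "op_trace A = (THE t. \<forall>B. orthonormal_basis B \<longrightarrow> ((\<lambda>e. A e \<bullet> e) has_sum t) B)"

(* Normal law with mean a and variance v; the case v = 0 is the Dirac measure at a. *)
definition real_normal :: "real \<Rightarrow> real \<Rightarrow> real measure" where
  "real_normal a v =
     (if v = 0 then return borel a else density lborel (\<lambda>x. ennreal (normal_density a (sqrt v) x)))"

definition gaussian_measure :: "'h::real_inner measure \<Rightarrow> bool" where
  "gaussian_measure \<mu> \<longleftrightarrow> prob_space \<mu> \<and> sets \<mu> = sets borel \<and>
     (\<forall>u. \<exists>a v. 0 \<le> v \<and> distr \<mu> borel (\<lambda>x. u \<bullet> x) = real_normal a v)"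

definition has_mean :: "'h::real_inner measure \<Rightarrow> 'h \<Rightarrow> bool" where
  "has_mean \<mu> m \<longleftrightarrow> (\<forall>u. (\<integral>x. u \<bullet> x \<partial>\<mu>) = u \<bullet> m)"

definition has_covariance :: "'h::real_inner measure \<Rightarrow> 'h \<Rightarrow> ('h \<Rightarrow>\<^sub>L 'h) \<Rightarrow> bool" where
  "has_covariance \<mu> m C \<longleftrightarrow>
     (\<forall>u v. (\<integral>x. (u \<bullet> (x - m)) * (v \<bullet> (x - m)) \<partial>\<mu>) = C u \<bullet> v)"

(* "\<mu> = N(m, C)" *)
definition is_gaussian :: "'h::real_inner measure \<Rightarrow> 'h \<Rightarrow> ('h \<Rightarrow>\<^sub>L 'h) \<Rightarrow> bool" where
  "is_gaussian \<mu> m C \<longleftrightarrow> gaussian_measure \<mu> \<and> has_mean \<mu> m \<and> has_covariance \<mu> m C"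

(* f is Frechet differentiable near m, its derivative f' is Frechet differentiable at m, and
   g, H are the Riesz representers of the first and second derivatives of f at m. *)
definition has_gradient_hessian ::
  "('h::real_inner \<Rightarrow> real) \<Rightarrow> 'h \<Rightarrow> 'h \<Rightarrow> ('h \<Rightarrow>\<^sub>L 'h) \<Rightarrow> bool" where
  "has_gradient_hessian f m g H \<longleftrightarrow>
     (\<exists>(f' :: 'h \<Rightarrow> 'h \<Rightarrow>\<^sub>L real) (f'' :: 'h \<Rightarrow>\<^sub>L 'h \<Rightarrow>\<^sub>L real).
        (\<forall>\<^sub>F x in nhds m. (f has_derivative blinfun_apply (f' x)) (at x)) \<and>
        (f' has_derivative blinfun_apply f'') (at m) \<and>
        (\<forall>u. blinfun_apply (f' m) u = g \<bullet> u) \<and>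
        (\<forall>u v. blinfun_apply (blinfun_apply f'' u) v = H u \<bullet> v))"

definition quad_approx ::
  "('h::real_inner \<Rightarrow> real) \<Rightarrow> 'h \<Rightarrow> 'h \<Rightarrow> ('h \<Rightarrow>\<^sub>L 'h) \<Rightarrow> 'h \<Rightarrow> real" where
  "quad_approx f m0 g H m = f m0 + g \<bullet> (m - m0) + 1/2 * (H (m - m0) \<bullet> (m - m0))"

end

theory Submission
  imports Defs
begin

text \<open>
Write \<open>X = m - mbar\<close>, \<open>S = op_sqrt C\<close> and \<open>Q = \<langle>H X, X\<rangle>\<close>.  The theorem is Wick's formula for Gaussian
moments, summed over a basis.  Every \<open>\<langle>u, X\<rangle>\<close> is a centred normal variable of variance \<open>\<langle>C u, u\<rangle>\<close>,
so the moments of one such variable are known, and polarization turns them into the mixed moments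
of up to four of them: the odd ones vanish, those of order two are values of the form of \<open>C\<close>, and
those of order four are sums over the three pairings (\<open>moment2\<close>, \<open>moment3\<close>, \<open>moment4\<close>).

If \<open>e\<close> is an orthonormal basis, then \<open>Q\<close> is the series of the products \<open>\<langle>H e\<^sub>i, X\<rangle> \<langle>e\<^sub>i, X\<rangle>\<close>.  As \<open>C\<close> has
finite trace, the norm of \<open>X\<close> has a finite fourth moment (\<open>integrable_norm_power4\<close>), and dominated
convergence allows \<open>W Q\<close> to be integrated term by term for every weight \<open>W\<close> of at most quadratic
growth (\<open>quadratic_form_expansion\<close>).  With \<open>T\<close> and \<open>R\<close> the traces of \<open>S H S\<close> and of its square, this gives

  \<open>E Q = T\<close>, \<open>E (\<langle>g, X\<rangle> Q) = 0\<close>,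
  \<open>E (\<langle>u, X\<rangle> \<langle>v, X\<rangle> Q) = T \<langle>C u, v\<rangle> + 2 \<langle>H C u, C v\<rangle>\<close>, \<open>E Q\<^sup>2 = T\<^sup>2 + 2 R\<close>,

where the last one comes from \<open>W = Q\<close>, by way of the one before.  Mean and variance of the quadratic polynomial follow by
expanding the square.

The series so obtained are \<open>\<Sum>i. \<langle>C H e\<^sub>i, e\<^sub>i\<rangle>\<close> and the same with \<open>H C H\<close> for \<open>H\<close>, and it remains to see
that they are traces.  First, \<open>S\<close> must exist and be unique for its definition to mean anything;
existence is by the binomial series
of \<open>sqrt (1 - B)\<close> (\<open>positive_contraction_complement_sqrt\<close>).  Second, the trace of an operator
with a nuclear representation \<open>\<Sum>j. \<langle>a\<^sub>j, \<cdot>\<rangle> b\<^sub>j\<close> is \<open>\<Sum>j. \<langle>a\<^sub>j, b\<^sub>j\<rangle>\<close> in every orthonormal basis, by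
Parseval and Fubini (\<open>nuclear_trace\<close>).  Third, \<open>S H S\<close> has the nuclear representation
\<open>a\<^sub>i = S e\<^sub>i\<close>, \<open>b\<^sub>i = S H e\<^sub>i\<close>, whose trace is the series above because \<open>S\<^sup>2 = C\<close>
(\<open>op_sqrt_sandwich\<close>); the square of \<open>S H S\<close> is the operator \<open>S (H C H) S\<close>, of the same shape.
\<close>

section \<open>The positive square root\<close>

text \<open>
The sort \<open>{real_normed_vector, complete_space}\<close> does not entail the class \<open>banach\<close>, so the comparison
with a series of norms is derived from completeness itself.
\<close>

lemma summable_if_norm_summable:
  fixes f :: "nat \<Rightarrow> 'a::{real_normed_vector, complete_space}"
  assumes "summable (\<lambda>n. norm (f n))"
  shows "summable f"
proof -
  have "Cauchy (\<lambda>n. \<Sum>i<n. f i)"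
  proof (rule CauchyI')
    fix e :: real assume "0 < e"
    with assms obtain N where N: "\<And>m n. m \<ge> N \<Longrightarrow> norm (\<Sum>i=m..<n. norm (f i)) < e"
      unfolding summable_Cauchy by blast
    have "dist (\<Sum>i<m. f i) (\<Sum>i<n. f i) < e" if "N \<le> m" "m < n" for m n
    proof -
      have "(\<Sum>i<n. f i) - (\<Sum>i<m. f i) = (\<Sum>i=m..<n. f i)"
        using that by (simp add: sum_diff_nat_ivl flip: atLeast0LessThan)
      then have "dist (\<Sum>i<m. f i) (\<Sum>i<n. f i) = norm (\<Sum>i=m..<n. f i)"
        by (metis dist_norm norm_minus_commute)
      also have "\<dots> \<le> norm (\<Sum>i=m..<n. norm (f i))"
        by (metis norm_sum order_trans real_norm_def abs_ge_self)
      also have "\<dots> < e" using N that by simp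
      finally show ?thesis .
    qed
    then show "\<exists>M. \<forall>m\<ge>M. \<forall>n>m. dist (\<Sum>i<m. f i) (\<Sum>i<n. f i) < e" by blast
  qed
  then show ?thesis
    by (simp add: Cauchy_convergent summable_iff_convergent)
qed

lemma L_symD: "A \<in> L_sym \<Longrightarrow> A x \<bullet> y = x \<bullet> A y"
  by (simp add: L_sym_def)

lemma positive_opD: "positive_op A \<Longrightarrow> 0 \<le> A x \<bullet> x"
  by (simp add: positive_op_def)

text \<open>
The usual discriminant argument; it works for semidefinite forms, where \<open>A y \<bullet> y\<close> may vanish for
\<open>y \<noteq> 0\<close>.
\<close>

lemma positive_form_Cauchy_Schwarz:
  assumes "A \<in> L_sym" "positive_op A"
  shows "(A x \<bullet> y)\<^sup>2 \<le> (A x \<bullet> x) * (A y \<bullet> y)"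
proof -
  have q: "0 \<le> s\<^sup>2 * (A x \<bullet> x) + 2 * s * t * (A x \<bullet> y) + t\<^sup>2 * (A y \<bullet> y)" for s t
  proof -
    have "A (s *\<^sub>R x + t *\<^sub>R y) \<bullet> (s *\<^sub>R x + t *\<^sub>R y)
        = s\<^sup>2 * (A x \<bullet> x) + 2 * s * t * (A x \<bullet> y) + t\<^sup>2 * (A y \<bullet> y)"
      using L_symD[OF assms(1), of y x]
      by (simp add: blinfun.add_right blinfun.scaleR_right inner_add_left inner_add_right
          power2_eq_square inner_commute algebra_simps)
    then show ?thesis using positive_opD[OF assms(2)] by metis
  qed
  let ?a = "A x \<bullet> x" and ?b = "A x \<bullet> y" and ?c = "A y \<bullet> y"
  have a: "0 \<le> ?a" and c: "0 \<le> ?c" using positive_opD[OF assms(2)] by auto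
  show ?thesis
  proof (cases "?c = 0")
    case False
    have "0 \<le> ?c * (?a * ?c - ?b\<^sup>2)"
      using q[of ?c "- ?b"] by (simp add: algebra_simps power2_eq_square)
    with c False show ?thesis by (simp add: zero_le_mult_iff)
  next
    case True
    have "?b = 0"
    proof (rule ccontr)
      assume "?b \<noteq> 0"
      then show False
        \<comment> \<open>Since \<open>?c = 0\<close>, the form is affine in its second coefficient, and this value would make it -1.\<close>
        using q[of 1 "- (?a + 1) / (2 * ?b)"] True by (simp add: field_simps)
    qed
    then show ?thesis using True by simp
  qed
qed

lemma positive_op_eq_0I:
  assumes "A \<in> L_sym" "positive_op A" "A x \<bullet> x = 0"
  shows "A x = 0"
  using positive_form_Cauchy_Schwarz[OF assms(1,2), of x "A x"] assms(3) by simp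

text \<open>
The coefficients of the Taylor series of \<open>sqrt (1 - t)\<close> at 0.
\<close>

definition sqrt_coeff :: "nat \<Rightarrow> real" where
  "sqrt_coeff k = (-1) ^ k * ((1/2) gchoose k)"

lemma sqrt_coeff_0 [simp]: "sqrt_coeff 0 = 1"
  by (simp add: sqrt_coeff_def)

lemma sqrt_coeff_Suc_nonpos: "sqrt_coeff (Suc k) \<le> 0"
proof -
  have "sqrt_coeff (Suc k) = - (1/2) * pochhammer (1/2) k / fact (Suc k)"
    by (simp add: sqrt_coeff_def gbinomial_pochhammer pochhammer_rec flip: power_add mult_2)
  moreover have "0 \<le> pochhammer (1/2::real) k"
    by (intro pochhammer_nonneg) simp
  ultimately show ?thesis by (simp add: divide_nonpos_pos)
qed

text \<open>
The partial sums of all coefficients have a closed form, which is nonnegative, and all coefficients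
but the first are nonpositive.  The constant 1 is sharp, and it is what makes the square root below
positive.
\<close>

lemma sum_abs_sqrt_coeff_Suc_le: "(\<Sum>k<n. \<bar>sqrt_coeff (Suc k)\<bar>) \<le> 1"
proof -
  have "(\<Sum>k\<le>n. sqrt_coeff k) = pochhammer (1/2) n / fact n"
    using gbinomial_sum_lower_neg[of "1/2::real" n]
    by (simp add: sqrt_coeff_def mult.commute gbinomial_pochhammer flip: power_add mult_2)
  also have "\<dots> \<ge> 0"
    by (intro divide_nonneg_nonneg pochhammer_nonneg) auto
  finally have "0 \<le> (\<Sum>k\<le>n. sqrt_coeff k)" .
  moreover have "(\<Sum>k\<le>n. sqrt_coeff k) = 1 - (\<Sum>k<n. \<bar>sqrt_coeff (Suc k)\<bar>)"
    using sqrt_coeff_Suc_nonpos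
    by (simp add: sum.atMost_shift sum_negf)
  ultimately show ?thesis by simp
qed

lemma summable_abs_sqrt_coeff: "summable (\<lambda>k. \<bar>sqrt_coeff k\<bar>)"
proof -
  have "summable (\<lambda>k. \<bar>sqrt_coeff (Suc k)\<bar>)"
    using sum_abs_sqrt_coeff_Suc_le by (intro summableI_nonneg_bounded) auto
  then show ?thesis by (rule summable_Suc_iff[THEN iffD1])
qed

text \<open>
The square of the series is \<open>1 - t\<close>: this is Vandermonde's identity for the exponents
\<open>1/2 + 1/2 = 1\<close>.
\<close>

lemma sqrt_coeff_convolution:
  "(\<Sum>j\<le>n. sqrt_coeff j * sqrt_coeff (n - j)) = (if n = 0 then 1 else if n = 1 then -1 else 0)"
proof -
  have "sqrt_coeff j * sqrt_coeff (n - j)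
      = (-1) ^ n * (((1/2) gchoose j) * ((1/2) gchoose (n - j)))" if "j \<le> n" for j
    using that by (simp add: sqrt_coeff_def mult_ac flip: power_add)
  then have "(\<Sum>j\<le>n. sqrt_coeff j * sqrt_coeff (n - j))
      = (-1) ^ n * (\<Sum>j\<le>n. ((1/2) gchoose j) * ((1/2::real) gchoose (n - j)))"
    by (simp add: sum_distrib_left)
  also have "\<dots> = (-1) ^ n * (1 gchoose n)"
    using gbinomial_Vandermonde[of "1/2::real" "1/2" n] by (simp add: atMost_atLeast0)
  also have "(1::real) gchoose n = of_nat (1 choose n)"
    by (metis binomial_gbinomial of_nat_1)
  also have "(-1) ^ n * \<dots> = (if n = 0 then 1 else if n = 1 then -1 else (0::real))"
    by (cases n; cases "n - 1") auto
  finally show ?thesis .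
qed

lemma has_sum_if_summable_on_and_sums:
  fixes f :: "nat \<Rightarrow> 'a::{topological_comm_monoid_add, t2_space}"
  assumes "f summable_on UNIV" "f sums s"
  shows "(f has_sum s) UNIV"
  using assms has_sum_infsum has_sum_imp_sums sums_unique2 by metis

text \<open>
A Cauchy product whose terms carry a further bounded factor that depends only on the sum of the two
indices.  With \<open>r n = \<langle>B\<^sup>n x, y\<rangle>\<close> it multiplies two power series in an operator weakly, so that only
scalar series have to be rearranged.
\<close>

lemma Cauchy_product_sums_Hankel:
  fixes c r :: "nat \<Rightarrow> real"
  assumes c: "summable (\<lambda>k. \<bar>c k\<bar>)" and r: "\<And>n. \<bar>r n\<bar> \<le> M"
    and inner: "\<And>j. (\<lambda>k. c k * r (j + k)) sums s j"
    and outer: "(\<lambda>j. c j * s j) sums t"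
  shows "(\<lambda>n. (\<Sum>j\<le>n. c j * c (n - j)) * r n) sums t"
proof -
  define f where "f = (\<lambda>(j, k). c j * (c k * r (j + k)))"
  have cs: "(\<lambda>k. norm (c k)) summable_on UNIV"
    using c by (simp add: summable_on_UNIV_nonneg_real_iff)
  obtain L where L: "((\<lambda>k. \<bar>c k\<bar>) has_sum L) UNIV"
    using cs by (auto simp: summable_on_def)
  have "(\<lambda>p. norm (case p of (j, k) \<Rightarrow> M * (c j * c k))) summable_on UNIV \<times> UNIV"
  proof (rule summable_on_SigmaI)
    show "((\<lambda>k. norm (case (j, k) of (j, k) \<Rightarrow> M * (c j * c k))) has_sum (\<bar>M\<bar> * \<bar>c j\<bar>) * L) UNIV" for j
      using has_sum_cmult_right[OF L, of "\<bar>M\<bar> * \<bar>c j\<bar>"] by (simp add: abs_mult mult.assoc)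
    show "(\<lambda>j. (\<bar>M\<bar> * \<bar>c j\<bar>) * L) summable_on UNIV"
      using cs by (intro summable_on_cmult_left summable_on_cmult_right) simp
  qed auto
  then have "(\<lambda>p. norm (f p)) summable_on UNIV \<times> UNIV"
  proof (rule Infinite_Sum.abs_summable_on_comparison_test)
    fix p :: "nat \<times> nat"
    have "\<bar>c (fst p) * (c (snd p) * r (fst p + snd p))\<bar> \<le> \<bar>c (fst p)\<bar> * (\<bar>c (snd p)\<bar> * M)"
      unfolding abs_mult by (intro mult_left_mono r) auto
    moreover have "M \<ge> 0" using r[of 0] by linarith
    ultimately show "norm (f p) \<le> norm (case p of (j, k) \<Rightarrow> M * (c j * c k))"
      by (simp add: f_def case_prod_unfold abs_mult mult_ac)
  qed
  then have fs: "f summable_on UNIV \<times> UNIV"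
    using summable_on_iff_abs_summable_on_real by blast
  then obtain u where u: "(f has_sum u) (UNIV \<times> UNIV)"
    by (auto simp: summable_on_def)
  have row: "((\<lambda>k. f (j, k)) has_sum (c j * s j)) UNIV" for j
  proof -
    have "(\<lambda>k. f (j, k)) summable_on UNIV"
      using summable_on_SigmaD1[where f = "\<lambda>j k. f (j, k)" and A = UNIV and B = "\<lambda>_. UNIV"] fs by simp
    moreover have "(\<lambda>k. f (j, k)) sums (c j * s j)"
      using sums_mult[OF inner, of "c j"] by (simp add: f_def)
    ultimately show ?thesis
      by (rule has_sum_if_summable_on_and_sums)
  qed
  have "((\<lambda>j. c j * s j) has_sum u) UNIV"
    using has_sum_SigmaD[OF u row] by simp
  then have "u = t"
    using outer has_sum_imp_sums sums_unique2 by blast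
  have bij: "bij_betw (\<lambda>(n, j). (j, n - j)) (SIGMA n:UNIV. {..n}) (UNIV \<times> (UNIV :: nat set))"
    by (rule bij_betwI[where g = "\<lambda>(j, k). (j + k, j)"]) auto
  have "((\<lambda>p. f (case p of (n, j) \<Rightarrow> (j, n - j))) has_sum t) (SIGMA n:UNIV. {..n})"
    using has_sum_reindex_bij_betw[OF bij, of f t] u \<open>u = t\<close> by simp
  then have "((\<lambda>n. \<Sum>j\<le>n. f (j, n - j)) has_sum t) UNIV"
    by (rule has_sum_SigmaD) (simp add: has_sum_finite)
  then have "(\<lambda>n. \<Sum>j\<le>n. f (j, n - j)) sums t"
    by (rule has_sum_imp_sums)
  then show ?thesis
    by (simp add: f_def sum_distrib_right mult.assoc)
qed

text \<open>
The square root of \<open>1 - B\<close> is the binomial series in \<open>B\<close>, summed pointwise.  Being a limit of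
polynomials in \<open>B\<close>, it commutes with everything that commutes with \<open>B\<close>, which is what the
uniqueness of the square root rests on.
\<close>

lemma positive_contraction_complement_sqrt:
  fixes B :: "'h::{real_inner, complete_space} \<Rightarrow>\<^sub>L 'h"
  assumes sym: "B \<in> L_sym" and contr: "\<And>x. norm (B x) \<le> norm x"
  shows "\<exists>S :: 'h \<Rightarrow>\<^sub>L 'h. S \<in> L_sym \<and> positive_op S \<and> (\<forall>x. S (S x) = x - B x) \<and>
    (\<forall>T :: 'h \<Rightarrow>\<^sub>L 'h. (\<forall>y. T (B y) = B (T y)) \<longrightarrow> (\<forall>x. T (S x) = S (T x)))"
proof -
  define P where "P = (\<lambda>k. blinfun_apply B ^^ k)"
  have P_0: "P 0 x = x" and P_Suc: "P (Suc k) x = B (P k x)" for k x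
    by (simp_all add: P_def)
  have P_lin: "linear (P k)" for k
  proof (induction k)
    case 0 show ?case by (simp add: P_def id_def linear_iff)
  next
    case (Suc k) then show ?case
      by (simp add: linear_iff P_Suc blinfun.add_right blinfun.scaleR_right)
  qed
  have P_norm: "norm (P k x) \<le> norm x" for k x
    by (induction k) (auto simp: P_0 P_Suc intro: order_trans[OF contr])
  have P_shift: "P j (B x) = B (P j x)" for j x
    by (simp add: P_def funpow_swap1)
  have P_inner: "P j x \<bullet> P k y = P (j + k) x \<bullet> y" for j k x y
  proof (induction k arbitrary: y)
    case (Suc k)
    have "P j x \<bullet> P (Suc k) y = P j x \<bullet> P k (B y)" by (simp add: P_Suc P_shift)
    also have "\<dots> = P (j + k) x \<bullet> B y" by (rule Suc)
    also have "\<dots> = P (j + Suc k) x \<bullet> y" by (simp add: P_Suc L_symD[OF sym])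
    finally show ?case .
  qed (simp add: P_0)
  have term_bound: "norm (sqrt_coeff k *\<^sub>R P k x) \<le> \<bar>sqrt_coeff k\<bar> * norm x" for k x
    using P_norm by (simp add: mult_left_mono)
  define S0 where "S0 = (\<lambda>x. \<Sum>k. sqrt_coeff k *\<^sub>R P k x)"
  have nsum: "summable (\<lambda>k. norm (sqrt_coeff k *\<^sub>R P k x))" for x
  proof (rule summable_comparison_test')
    show "summable (\<lambda>k. \<bar>sqrt_coeff k\<bar> * norm x)"
      by (rule summable_mult2[OF summable_abs_sqrt_coeff])
    show "norm (norm (sqrt_coeff k *\<^sub>R P k x)) \<le> \<bar>sqrt_coeff k\<bar> * norm x" if "0 \<le> k" for k
      unfolding real_norm_def abs_norm_cancel by (rule term_bound)
  qed
  have sums: "(\<lambda>k. sqrt_coeff k *\<^sub>R P k x) sums S0 x" for x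
    unfolding S0_def by (rule summable_sums[OF summable_if_norm_summable[OF nsum]])
  have add: "S0 (x + y) = S0 x + S0 y" for x y
    using sums_add[OF sums[of x] sums[of y]] sums[of "x + y"]
    by (simp add: linear_add[OF P_lin] scaleR_add_right sums_unique2)
  have scale: "S0 (a *\<^sub>R x) = a *\<^sub>R S0 x" for a x
    using sums_scaleR_right[OF sums[of x], of a] sums[of "a *\<^sub>R x"]
    by (simp add: linear_scale[OF P_lin] mult.commute sums_unique2)
  have "norm (S0 x) \<le> norm x * (\<Sum>k. \<bar>sqrt_coeff k\<bar>)" for x
  proof -
    have "(\<lambda>n. norm (\<Sum>k<n. sqrt_coeff k *\<^sub>R P k x)) \<longlonglongrightarrow> norm (S0 x)"
      using sums[of x] unfolding sums_def by (rule tendsto_norm)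
    moreover have "norm (\<Sum>k<n. sqrt_coeff k *\<^sub>R P k x) \<le> norm x * (\<Sum>k. \<bar>sqrt_coeff k\<bar>)" for n
    proof -
      have "norm (\<Sum>k<n. sqrt_coeff k *\<^sub>R P k x) \<le> (\<Sum>k<n. \<bar>sqrt_coeff k\<bar> * norm x)"
        by (rule order_trans[OF norm_sum sum_mono]) (use term_bound in simp)
      also have "\<dots> = norm x * (\<Sum>k<n. \<bar>sqrt_coeff k\<bar>)"
        by (simp add: sum_distrib_left mult.commute)
      also have "\<dots> \<le> norm x * (\<Sum>k. \<bar>sqrt_coeff k\<bar>)"
        by (intro mult_left_mono sum_le_suminf summable_abs_sqrt_coeff) auto
      finally show ?thesis .
    qed
    ultimately show ?thesis by (blast intro: LIMSEQ_le_const2)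
  qed
  then have bl: "bounded_linear S0"
    by (intro bounded_linear_intro[of S0]) (auto simp: add scale)
  define S where "S = Blinfun S0"
  have S: "S x = S0 x" for x
    by (simp add: S_def bounded_linear_Blinfun_apply[OF bl])
  have inner_sums: "(\<lambda>k. sqrt_coeff k * (P k x \<bullet> y)) sums (S x \<bullet> y)" for x y
    using bounded_linear.sums[OF bounded_linear_inner_left sums[of x], of y] by (simp add: S)
  have P_sym: "P k x \<bullet> y = x \<bullet> P k y" for k x y
    using P_inner[of 0 x k y] by (simp add: P_0)
  have S_sym: "S x \<bullet> y = x \<bullet> S y" for x y
  proof -
    have "P k y \<bullet> x = P k x \<bullet> y" for k
      by (metis P_sym inner_commute)
    then have "S y \<bullet> x = S x \<bullet> y"
      using inner_sums[of x y] inner_sums[of y x] by (simp add: sums_unique2)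
    then show ?thesis by (simp add: inner_commute)
  qed
  then have "S \<in> L_sym" by (simp add: L_sym_def)
  moreover have "positive_op S"
    unfolding positive_op_def
  proof
    fix x
    have "0 \<le> (\<Sum>k<Suc n. sqrt_coeff k * (P k x \<bullet> x))" for n
    proof -
      have "\<bar>sqrt_coeff (Suc k) * (P (Suc k) x \<bullet> x)\<bar> \<le> \<bar>sqrt_coeff (Suc k)\<bar> * (x \<bullet> x)" for k
      proof -
        have "\<bar>P (Suc k) x \<bullet> x\<bar> \<le> norm (P (Suc k) x) * norm x"
          by (rule Cauchy_Schwarz_ineq2)
        also have "\<dots> \<le> x \<bullet> x"
          by (simp add: dot_square_norm power2_eq_square mult_right_mono P_norm)
        finally show ?thesis by (simp add: abs_mult mult_left_mono)
      qed
      then have "\<bar>\<Sum>k<n. sqrt_coeff (Suc k) * (P (Suc k) x \<bullet> x)\<bar> \<le> (\<Sum>k<n. \<bar>sqrt_coeff (Suc k)\<bar> * (x \<bullet> x))"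
        by (intro order_trans[OF sum_abs sum_mono]) auto
      also have "\<dots> \<le> 1 * (x \<bullet> x)"
        unfolding sum_distrib_right[symmetric]
        by (intro mult_right_mono sum_abs_sqrt_coeff_Suc_le) auto
      finally show ?thesis
        unfolding sum.lessThan_Suc_shift by (simp add: P_0)
    qed
    moreover have "(\<lambda>n. \<Sum>k<Suc n. sqrt_coeff k * (P k x \<bullet> x)) \<longlonglongrightarrow> S x \<bullet> x"
      using inner_sums[of x x] LIMSEQ_Suc unfolding sums_def by blast
    ultimately show "0 \<le> S x \<bullet> x"
      using LIMSEQ_le_const by blast
  qed
  moreover have "S (S x) = x - B x" for x
  proof -
    have "S (S x) \<bullet> y = (x - B x) \<bullet> y" for y
    proof -
      have "(\<lambda>n. (\<Sum>j\<le>n. sqrt_coeff j * sqrt_coeff (n - j)) * (P n x \<bullet> y)) sums (S x \<bullet> S y)"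
      proof (rule Cauchy_product_sums_Hankel[OF summable_abs_sqrt_coeff])
        show "\<bar>P n x \<bullet> y\<bar> \<le> norm x * norm y" for n
          by (rule order_trans[OF Cauchy_Schwarz_ineq2]) (simp add: mult_right_mono P_norm)
        show "(\<lambda>k. sqrt_coeff k * (P (j + k) x \<bullet> y)) sums (P j x \<bullet> S y)" for j
          using inner_sums[of y "P j x"] by (simp add: inner_commute[of _ "P j x"] P_inner)
        show "(\<lambda>j. sqrt_coeff j * (P j x \<bullet> S y)) sums (S x \<bullet> S y)"
          by (rule inner_sums)
      qed
      moreover have "(\<lambda>n. (\<Sum>j\<le>n. sqrt_coeff j * sqrt_coeff (n - j)) * (P n x \<bullet> y))
          sums (\<Sum>n\<in>{0, 1}. (\<Sum>j\<le>n. sqrt_coeff j * sqrt_coeff (n - j)) * (P n x \<bullet> y))"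
        by (rule sums_finite) (auto simp: sqrt_coeff_convolution)
      ultimately have "S x \<bullet> S y = P 0 x \<bullet> y - P 1 x \<bullet> y"
        using sums_unique2 by (fastforce simp: sqrt_coeff_convolution)
      then show ?thesis
        by (simp add: S_sym P_0 P_Suc inner_diff_left)
    qed
    then show ?thesis by (metis vector_eq_rdot)
  qed
  moreover have "T (S x) = S (T x)" if comm: "\<forall>y. T (B y) = B (T y)" for T :: "'h \<Rightarrow>\<^sub>L 'h" and x
  proof -
    have PT: "T (P k y) = P k (T y)" for k y
      by (induction k) (simp_all add: P_0 P_Suc comm)
    have "(\<lambda>k. T (sqrt_coeff k *\<^sub>R P k x)) sums T (S0 x)"
      by (rule bounded_linear.sums[OF blinfun.bounded_linear_right sums])
    then show ?thesis
      using sums[of "T x"] by (simp add: S blinfun.scaleR_right PT sums_unique2)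
  qed
  ultimately show ?thesis by blast
qed

text \<open>
Scaling by \<open>c = norm A + 1\<close> gives \<open>A = c (1 - B)\<close> with \<open>0 \<le> B \<le> 1\<close>.
\<close>

lemma positive_sqrt_exists_commuting:
  fixes A :: "'h::{real_inner, complete_space} \<Rightarrow>\<^sub>L 'h"
  assumes sym: "A \<in> L_sym" and pos: "positive_op A"
  shows "\<exists>S :: 'h \<Rightarrow>\<^sub>L 'h. S \<in> L_sym \<and> positive_op S \<and> S o\<^sub>L S = A \<and>
    (\<forall>T :: 'h \<Rightarrow>\<^sub>L 'h. (\<forall>y. T (A y) = A (T y)) \<longrightarrow> (\<forall>x. T (S x) = S (T x)))"
proof -
  define c where "c = norm A + 1"
  have c: "0 < c" by (simp add: c_def add_nonneg_pos)
  define B where "B = id_blinfun - (1 / c) *\<^sub>R A"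
  have B: "B x = x - (1 / c) *\<^sub>R A x" for x
    by (simp add: B_def blinfun.diff_left blinfun.scaleR_left)
  have B_sym: "B \<in> L_sym"
    using sym by (simp add: L_sym_def B inner_diff_left inner_diff_right)
  have Ax: "A x \<bullet> x \<le> c * (x \<bullet> x)" for x
  proof -
    have "A x \<bullet> x \<le> norm (A x) * norm x" by (rule norm_cauchy_schwarz)
    also have "\<dots> \<le> (norm A * norm x) * norm x"
      by (intro mult_right_mono norm_blinfun) auto
    also have "\<dots> \<le> c * (x \<bullet> x)"
      by (simp add: c_def dot_square_norm power2_eq_square algebra_simps)
    finally show ?thesis .
  qed
  have Bx: "0 \<le> B x \<bullet> x" "B x \<bullet> x \<le> x \<bullet> x" for x
    using Ax[of x] positive_opD[OF pos, of x] c by (auto simp: B inner_diff_left field_simps)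
  then have B_pos: "positive_op B" by (simp add: positive_op_def)
  have contr: "norm (B x) \<le> norm x" for x
  proof -
    have "(B x \<bullet> B x)\<^sup>2 \<le> (B x \<bullet> x) * (B (B x) \<bullet> B x)"
      by (rule positive_form_Cauchy_Schwarz[OF B_sym B_pos])
    also have "\<dots> \<le> (x \<bullet> x) * (B x \<bullet> B x)"
      by (intro mult_mono Bx) auto
    finally have "(norm (B x))\<^sup>2 * (norm (B x))\<^sup>2 \<le> (norm x)\<^sup>2 * (norm (B x))\<^sup>2"
      by (simp add: dot_square_norm power2_eq_square)
    then show ?thesis
    proof (cases "B x = 0")
      case False
      assume "(norm (B x))\<^sup>2 * (norm (B x))\<^sup>2 \<le> (norm x)\<^sup>2 * (norm (B x))\<^sup>2"
      then have "(norm (B x))\<^sup>2 \<le> (norm x)\<^sup>2"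
        by (rule mult_right_le_imp_le) (use False in simp)
      then show ?thesis by (rule power2_le_imp_le) simp
    qed simp
  qed
  obtain R :: "'h \<Rightarrow>\<^sub>L 'h" where R: "R \<in> L_sym" "positive_op R" "\<forall>x. R (R x) = x - B x"
      "\<forall>T :: 'h \<Rightarrow>\<^sub>L 'h. (\<forall>y. T (B y) = B (T y)) \<longrightarrow> (\<forall>x. T (R x) = R (T x))"
    using positive_contraction_complement_sqrt[OF B_sym contr] by blast
  define S where "S = sqrt c *\<^sub>R R"
  have S: "S x = sqrt c *\<^sub>R R x" for x
    by (simp add: S_def blinfun.scaleR_left)
  show ?thesis
  proof (intro exI[of _ S] conjI allI impI)
    show "S \<in> L_sym" using R(1) by (simp add: L_sym_def S)
    show "positive_op S" using R(2) c by (simp add: positive_op_def S)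
    show "S o\<^sub>L S = A"
      using c by (intro blinfun_eqI) (simp add: S blinfun.scaleR_right R(3) B)
    show "T (S x) = S (T x)" if "\<forall>y. T (A y) = A (T y)" for T :: "'h \<Rightarrow>\<^sub>L 'h" and x
    proof -
      have "T (B y) = B (T y)" for y
        by (simp add: B blinfun.diff_right blinfun.scaleR_right that)
      then have "T (R x) = R (T x)" using R(4) by blast
      then show ?thesis by (simp add: S blinfun.scaleR_right)
    qed
  qed
qed

text \<open>
For \<open>y = (S - T) x\<close> commutation gives \<open>(S + T) y = (S\<^sup>2 - T\<^sup>2) x = 0\<close>.  Both terms of
\<open>\<langle>S y, y\<rangle> + \<langle>T y, y\<rangle> = 0\<close> are nonnegative, hence \<open>S y = T y = 0\<close>, and then
\<open>\<langle>y, y\<rangle> = \<langle>x, (S - T) y\<rangle> = 0\<close>.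
\<close>

lemma positive_sqrt_unique:
  fixes S T :: "'h::real_inner \<Rightarrow>\<^sub>L 'h"
  assumes S: "S \<in> L_sym" "positive_op S" and T: "T \<in> L_sym" "positive_op T"
    and sq: "S o\<^sub>L S = T o\<^sub>L T" and comm: "\<And>x. T (S x) = S (T x)"
  shows "T = S"
proof (rule blinfun_eqI)
  fix x
  have sq': "S (S y) = T (T y)" for y
    using sq by (metis blinfun_apply_blinfun_compose)
  define y where "y = S x - T x"
  have "S y + T y = 0"
    by (simp add: y_def blinfun.diff_right comm sq')
  then have "S y \<bullet> y + T y \<bullet> y = 0"
    by (simp flip: inner_add_left)
  then have "S y \<bullet> y = 0" "T y \<bullet> y = 0"
    using positive_opD[OF S(2), of y] positive_opD[OF T(2), of y] by linarith+
  then have "S y = 0" "T y = 0"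
    using positive_op_eq_0I S T by blast+
  then have "(S x - T x) \<bullet> y = 0"
    using L_symD[OF S(1), of x y] L_symD[OF T(1), of x y] by (simp add: inner_diff_left)
  then have "y = 0" by (simp add: y_def)
  then show "T x = S x" by (simp add: y_def)
qed

lemma op_sqrt:
  fixes A :: "'h::{real_inner, complete_space} \<Rightarrow>\<^sub>L 'h"
  assumes "A \<in> L_sym" "positive_op A"
  shows op_sqrt_sym: "op_sqrt A \<in> L_sym" and op_sqrt_square: "op_sqrt A (op_sqrt A x) = A x"
proof -
  obtain S :: "'h \<Rightarrow>\<^sub>L 'h" where S: "S \<in> L_sym" "positive_op S" "S o\<^sub>L S = A"
      "\<forall>T :: 'h \<Rightarrow>\<^sub>L 'h. (\<forall>y. T (A y) = A (T y)) \<longrightarrow> (\<forall>x. T (S x) = S (T x))"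
    using positive_sqrt_exists_commuting[OF assms] by blast
  have "op_sqrt A = S"
    unfolding op_sqrt_def
  proof (rule the_equality)
    fix T :: "'h \<Rightarrow>\<^sub>L 'h" assume T: "T \<in> L_sym \<and> positive_op T \<and> T o\<^sub>L T = A"
    then have "A y = T (T y)" for y by auto
    then have comm: "T (S x) = S (T x)" for x using S(4) by metis
    have "S o\<^sub>L S = T o\<^sub>L T" using T S(3) by metis
    then show "T = S"
      using T positive_sqrt_unique[OF S(1,2) _ _ _ comm] by blast
  qed (use S(1-3) in blast)
  moreover have "S (S x) = A x"
    using S(3) by (metis blinfun_apply_blinfun_compose)
  ultimately show "op_sqrt A \<in> L_sym" "op_sqrt A (op_sqrt A x) = A x"
    using S(1) by simp_all
qed

section \<open>Parseval families and the trace\<close>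

lemma Gram_Schmidt_residual_orthogonal:
  assumes "finite F" "pairwise orthogonal F" "\<forall>e\<in>F. norm e = 1" "y \<in> span F"
  shows "orthogonal (x - (\<Sum>e\<in>F. (x \<bullet> e) *\<^sub>R e)) y"
proof (rule orthogonal_to_span[OF assms(4)])
  fix f assume f: "f \<in> F"
  have "(\<Sum>e\<in>F. (x \<bullet> e) *\<^sub>R e) \<bullet> f = (\<Sum>e\<in>F. if e = f then x \<bullet> f else 0)"
    unfolding inner_sum_left
  proof (rule sum.cong)
    fix e assume e: "e \<in> F"
    have "f \<bullet> f = 1" using assms(3) f by (simp add: dot_square_norm)
    moreover have "e \<bullet> f = 0" if "e \<noteq> f"
      using assms(2) e f that by (auto simp: pairwise_def orthogonal_def)
    ultimately show "(x \<bullet> e) *\<^sub>R e \<bullet> f = (if e = f then x \<bullet> f else 0)" by simp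
  qed simp
  then show "orthogonal (x - (\<Sum>e\<in>F. (x \<bullet> e) *\<^sub>R e)) f"
    using assms(1) f by (simp add: orthogonal_def inner_diff_left)
qed

lemma Bessel_identity:
  assumes F: "finite F" "pairwise orthogonal F" "\<forall>e\<in>F. norm e = 1"
  shows "(norm (x - (\<Sum>e\<in>F. (x \<bullet> e) *\<^sub>R e)))\<^sup>2 = (norm x)\<^sup>2 - (\<Sum>e\<in>F. (x \<bullet> e)\<^sup>2)"
proof -
  let ?p = "\<Sum>e\<in>F. (x \<bullet> e) *\<^sub>R e"
  have "?p \<in> span F"
    by (intro span_sum span_scale span_base)
  then have "(x - ?p) \<bullet> ?p = 0"
    using Gram_Schmidt_residual_orthogonal[OF F] by (auto simp: orthogonal_def)
  then have "(norm (x - ?p))\<^sup>2 = x \<bullet> x - x \<bullet> ?p"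
    unfolding power2_norm_eq_inner by (simp add: inner_diff_left inner_diff_right inner_commute)
  also have "x \<bullet> ?p = (\<Sum>e\<in>F. (x \<bullet> e)\<^sup>2)"
    by (simp add: inner_sum_right power2_eq_square)
  finally show ?thesis by (simp add: power2_norm_eq_inner)
qed

lemma orthonormal_projection_minimal:
  assumes F: "finite F" "pairwise orthogonal F" "\<forall>e\<in>F. norm e = 1" and y: "y \<in> span F"
  shows "norm (x - (\<Sum>e\<in>F. (x \<bullet> e) *\<^sub>R e)) \<le> norm (x - y)"
proof -
  let ?p = "\<Sum>e\<in>F. (x \<bullet> e) *\<^sub>R e"
  have "?p - y \<in> span F"
    by (intro span_diff[OF _ y] span_sum span_scale span_base)
  then have "orthogonal (x - ?p) (?p - y)"
    by (rule Gram_Schmidt_residual_orthogonal[OF F])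
  then have "(norm (x - ?p + (?p - y)))\<^sup>2 = (norm (x - ?p))\<^sup>2 + (norm (?p - y))\<^sup>2"
    by (rule norm_add_Pythagorean)
  then have "(norm (x - ?p))\<^sup>2 \<le> (norm (x - y))\<^sup>2" by simp
  then show ?thesis by (rule power2_le_imp_le) simp
qed

text \<open>
Only Parseval's identity is ever used of a basis.  Stated for indexed families, it covers both
orthonormal sets and sequences, and a sequence may be padded with zero vectors, so that finite and
infinite bases need no distinction.
\<close>

definition parseval_family :: "'i set \<Rightarrow> ('i \<Rightarrow> 'h::real_inner) \<Rightarrow> bool" where
  "parseval_family I e \<longleftrightarrow> (\<forall>x y. ((\<lambda>i. (e i \<bullet> x) * (e i \<bullet> y)) has_sum (x \<bullet> y)) I)"

lemma parseval_familyD: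
  "parseval_family I e \<Longrightarrow> ((\<lambda>i. (e i \<bullet> x) * (e i \<bullet> y)) has_sum (x \<bullet> y)) I"
  by (simp add: parseval_family_def)

lemma parseval_sums:
  "parseval_family UNIV (e :: nat \<Rightarrow> 'h::real_inner) \<Longrightarrow> (\<lambda>i. (e i \<bullet> x) * (e i \<bullet> y)) sums (x \<bullet> y)"
  by (intro has_sum_imp_sums parseval_familyD)

text \<open>
The defect in Bessel's inequality is the squared distance to the span of finitely many basis
vectors, which tends to 0 because the span of the basis is dense.  Polarization passes from squares
to products.
\<close>

lemma orthonormal_basis_parseval:
  fixes B :: "'h::real_inner set"
  assumes B: "orthonormal_basis B"
  shows "parseval_family B (\<lambda>e. e)"
proof -
  have sq: "((\<lambda>e. (x \<bullet> e)\<^sup>2) has_sum (norm x)\<^sup>2) B" for x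
    unfolding has_sum_def
  proof (rule tendstoI)
    fix \<epsilon> :: real assume \<epsilon>: "0 < \<epsilon>"
    have "x \<in> closure (span B)" using B by (simp add: orthonormal_basis_def)
    then obtain y where y: "y \<in> span B" "dist y x < sqrt \<epsilon>"
      using \<epsilon> by (metis closure_approachable real_sqrt_gt_0_iff)
    then obtain T where T: "finite T" "T \<subseteq> B" "y \<in> span T"
      using span_explicit[of B] span_sum span_scale span_base
      by (smt (verit, ccfv_SIG) mem_Collect_eq)
    have "dist (\<Sum>e\<in>F. (x \<bullet> e)\<^sup>2) ((norm x)\<^sup>2) < \<epsilon>" if F: "finite F" "T \<subseteq> F" "F \<subseteq> B" for F
    proof -
      have orth: "pairwise orthogonal F" "\<forall>e\<in>F. norm e = 1"
        using B F(3) by (auto simp: orthonormal_basis_def intro: pairwise_subset)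
      have "y \<in> span F" using T(3) F(2) span_mono by blast
      then have "norm (x - (\<Sum>e\<in>F. (x \<bullet> e) *\<^sub>R e)) \<le> norm (x - y)"
        by (intro orthonormal_projection_minimal F(1) orth)
      also have "\<dots> < sqrt \<epsilon>" using y(2) by (simp add: dist_norm norm_minus_commute)
      finally have "(norm (x - (\<Sum>e\<in>F. (x \<bullet> e) *\<^sub>R e)))\<^sup>2 < \<epsilon>"
        using \<epsilon> by (metis norm_ge_zero real_sqrt_pow2 power_strict_mono less_imp_le zero_less_numeral)
      then have "(norm x)\<^sup>2 - (\<Sum>e\<in>F. (x \<bullet> e)\<^sup>2) < \<epsilon>" "0 \<le> (norm x)\<^sup>2 - (\<Sum>e\<in>F. (x \<bullet> e)\<^sup>2)"
        unfolding Bessel_identity[OF F(1) orth, symmetric] by auto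
      then show ?thesis by (simp add: dist_real_def)
    qed
    then show "\<forall>\<^sub>F F in finite_subsets_at_top B. dist (\<Sum>e\<in>F. (x \<bullet> e)\<^sup>2) ((norm x)\<^sup>2) < \<epsilon>"
      unfolding eventually_finite_subsets_at_top using T by (intro exI[of _ T]) auto
  qed
  have polar: "(e \<bullet> x) * (e \<bullet> y) = (1/4) * (((x + y) \<bullet> e)\<^sup>2 + - ((x - y) \<bullet> e)\<^sup>2)" for e x y :: 'h
    by (simp add: inner_add_right inner_diff_right inner_commute[of _ e] power2_eq_square algebra_simps)
  have "x \<bullet> y = (1/4) * ((norm (x + y))\<^sup>2 + - (norm (x - y))\<^sup>2)" for x y :: 'h
    unfolding power2_norm_eq_inner
    by (simp add: inner_add_left inner_add_right inner_diff_left inner_diff_right inner_commute)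
  moreover have "((\<lambda>e. (1/4) * (((x + y) \<bullet> e)\<^sup>2 + - ((x - y) \<bullet> e)\<^sup>2)) has_sum
      (1/4) * ((norm (x + y))\<^sup>2 + - (norm (x - y))\<^sup>2)) B" for x y :: 'h
    by (intro has_sum_cmult_right has_sum_add has_sum_uminusI sq)
  ultimately show ?thesis
    unfolding parseval_family_def polar by metis
qed

text \<open>
Gram-Schmidt applied to a dense sequence, leaving out the vectors that depend on earlier ones.
The existence of some orthonormal basis is needed for the trace, too: without one, its defining
condition would hold of every number.
\<close>

lemma orthonormal_basis_exists_countable:
  "\<exists>B :: 'h::{real_inner, second_countable_topology} set. orthonormal_basis B \<and> countable B"
proof -
  obtain D :: "'h set" where D: "countable D" "\<And>X. open X \<Longrightarrow> X \<noteq> {} \<Longrightarrow> \<exists>d\<in>D. d \<in> X"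
    using countable_dense_exists by blast
  have D_ne: "D \<noteq> {}" using D(2)[of UNIV] by auto
  define d where "d = from_nat_into D"
  define r where "r = (\<lambda>(G :: 'h set) n. d n - (\<Sum>e\<in>G. (d n \<bullet> e) *\<^sub>R e))"
  \<comment> \<open>Stage \<open>n\<close> is the set of vectors obtained from the first \<open>n\<close> members of the dense sequence.\<close>
  define G where "G = rec_nat {} (\<lambda>n G. if r G n = 0 then G else insert (sgn (r G n)) G)"
  have G_0: "G 0 = {}" and G_Suc: "G (Suc n) = (if r (G n) n = 0 then G n else insert (sgn (r (G n) n)) (G n))" for n
    by (simp_all add: G_def)
  have G: "finite (G n) \<and> pairwise orthogonal (G n) \<and> (\<forall>e\<in>G n. norm e = 1)" for n
  proof (induction n)
    case 0 show ?case by (simp add: G_0)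
  next
    case (Suc n)
    have "orthogonal (r (G n) n) e" if "e \<in> G n" for e
      unfolding r_def by (rule Gram_Schmidt_residual_orthogonal) (use Suc that in \<open>auto intro: span_base\<close>)
    then have "orthogonal (sgn (r (G n) n)) e \<and> orthogonal e (sgn (r (G n) n))" if "e \<in> G n" for e
      using that by (auto simp: sgn_div_norm orthogonal_def inner_commute)
    then show ?case
      using Suc by (auto simp: G_Suc norm_sgn pairwise_insert)
  qed
  have G_mono: "G m \<subseteq> G n" if "m \<le> n" for m n
    by (rule lift_Suc_mono_le[OF _ that]) (auto simp: G_Suc)
  define B where "B = (\<Union>n. G n)"
  have "pairwise orthogonal B"
    unfolding pairwise_def
  proof (intro ballI impI)
    fix x y assume xy: "x \<in> B" "y \<in> B" "x \<noteq> y"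
    then obtain m n where "x \<in> G m" "y \<in> G n" by (auto simp: B_def)
    then have "x \<in> G (max m n)" "y \<in> G (max m n)"
      using G_mono[of m "max m n"] G_mono[of n "max m n"] by auto
    then show "orthogonal x y" using G[of "max m n"] xy(3) by (auto simp: pairwise_def)
  qed
  moreover have "\<forall>e\<in>B. norm e = 1" using G by (auto simp: B_def)
  moreover have "d n \<in> span B" for n
  proof -
    have "r (G n) n \<in> span (G (Suc n))"
    proof (cases "r (G n) n = 0")
      case False
      then have "norm (r (G n) n) *\<^sub>R sgn (r (G n) n) \<in> span (G (Suc n))"
        by (intro span_scale span_base) (simp add: G_Suc)
      then show ?thesis using False by (simp add: sgn_div_norm)
    qed (simp add: span_zero)
    moreover have "(\<Sum>e\<in>G n. (d n \<bullet> e) *\<^sub>R e) \<in> span (G (Suc n))"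
      using G_mono[of n "Suc n"] by (intro span_sum span_scale span_base) auto
    ultimately have "r (G n) n + (\<Sum>e\<in>G n. (d n \<bullet> e) *\<^sub>R e) \<in> span (G (Suc n))"
      by (rule span_add)
    then have "d n \<in> span (G (Suc n))" by (simp add: r_def)
    then show ?thesis
      using span_mono[of "G (Suc n)" B] by (auto simp: B_def)
  qed
  then have D_span: "D \<subseteq> span B"
    using D(1) subset_range_from_nat_into[of D] by (auto simp: d_def)
  have "closure (span B) = UNIV"
  proof -
    have "x \<in> closure (span B)" for x
      unfolding closure_approachable
    proof (intro allI impI)
      fix \<epsilon> :: real assume "0 < \<epsilon>"
      then obtain y where "y \<in> D" "y \<in> ball x \<epsilon>" using D(2)[of "ball x \<epsilon>"] by auto
      then show "\<exists>y\<in>span B. dist y x < \<epsilon>"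
        using D_span by (auto simp: dist_commute)
    qed
    then show ?thesis by auto
  qed
  moreover have "countable B"
    unfolding B_def using G by (intro countable_UN) (auto intro: countable_finite)
  ultimately show ?thesis unfolding orthonormal_basis_def by blast
qed

lemma parseval_sequence_exists:
  "\<exists>e :: nat \<Rightarrow> 'h::{real_inner, second_countable_topology}. parseval_family UNIV e"
proof -
  obtain B :: "'h set" where B: "orthonormal_basis B" "countable B"
    using orthonormal_basis_exists_countable by blast
  define e where "e = (\<lambda>n. if n \<in> to_nat_on B ` B then from_nat_into B n else 0)"
  have bij: "bij_betw e (to_nat_on B ` B) B"
    by (rule bij_betwI[where g = "to_nat_on B"]) (auto simp: e_def B(2))
  have "parseval_family UNIV e"
    unfolding parseval_family_def
  proof (intro allI)
    fix x y
    have "((\<lambda>n. (e n \<bullet> x) * (e n \<bullet> y)) has_sum (x \<bullet> y)) (to_nat_on B ` B)"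
      using has_sum_reindex_bij_betw[OF bij, of "\<lambda>b. (b \<bullet> x) * (b \<bullet> y)"]
        parseval_familyD[OF orthonormal_basis_parseval[OF B(1)]] by blast
    then show "((\<lambda>n. (e n \<bullet> x) * (e n \<bullet> y)) has_sum (x \<bullet> y)) UNIV"
      by (rule has_sum_cong_neutral[THEN iffD1, rotated -1]) (auto simp: e_def)
  qed
  then show ?thesis by blast
qed

lemma parseval_Bessel:
  assumes "parseval_family I e" "finite F" "F \<subseteq> I"
  shows "(\<Sum>i\<in>F. (e i \<bullet> x)\<^sup>2) \<le> (norm x)\<^sup>2"
proof -
  have "((\<lambda>i. (e i \<bullet> x)\<^sup>2) has_sum (norm x)\<^sup>2) I"
    using parseval_familyD[OF assms(1), of x x] by (simp add: power2_eq_square dot_square_norm)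
  then show ?thesis
    by (rule finite_sum_le_has_sum) (use assms in auto)
qed

lemma parseval_sum_abs_le:
  assumes "parseval_family I e" "finite F" "F \<subseteq> I"
  shows "(\<Sum>i\<in>F. \<bar>(e i \<bullet> x) * (e i \<bullet> y)\<bar>) \<le> norm x * norm y"
proof (rule power2_le_imp_le)
  have "(\<Sum>i\<in>F. \<bar>(e i \<bullet> x) * (e i \<bullet> y)\<bar>)\<^sup>2 \<le> (\<Sum>i\<in>F. (e i \<bullet> x)\<^sup>2) * (\<Sum>i\<in>F. (e i \<bullet> y)\<^sup>2)"
    using Cauchy_Schwarz_ineq_sum[of "\<lambda>i. \<bar>e i \<bullet> x\<bar>" "\<lambda>i. \<bar>e i \<bullet> y\<bar>" F] by (simp add: abs_mult)
  also have "\<dots> \<le> (norm x)\<^sup>2 * (norm y)\<^sup>2"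
    by (intro mult_mono parseval_Bessel[OF assms] sum_nonneg) auto
  finally show "(\<Sum>i\<in>F. \<bar>(e i \<bullet> x) * (e i \<bullet> y)\<bar>)\<^sup>2 \<le> (norm x * norm y)\<^sup>2"
    by (simp add: power_mult_distrib)
qed simp

text \<open>
Both sides are iterated sums of \<open>\<langle>e\<^sub>i, a\<^sub>j\<rangle> \<langle>e\<^sub>i, b\<^sub>j\<rangle>\<close>.  Summed over \<open>i\<close> first, the absolute values
contribute at most \<open>norm a\<^sub>j * norm b\<^sub>j\<close>, so the order of summation is immaterial.
\<close>

lemma nuclear_trace:
  fixes A :: "'h::real_inner \<Rightarrow>\<^sub>L 'h"
  assumes e: "parseval_family I e"
    and ab: "summable (\<lambda>j. norm (a j) * norm (b j))"
    and A: "\<And>x. (\<lambda>j. (a j \<bullet> x) *\<^sub>R b j) sums A x"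
  shows "((\<lambda>i. A (e i) \<bullet> e i) has_sum (\<Sum>j. a j \<bullet> b j)) I"
proof -
  define f where "f = (\<lambda>(j :: nat, i). (e i \<bullet> a j) * (e i \<bullet> b j))"
  have row_abs: "(\<lambda>i. \<bar>f (j, i)\<bar>) summable_on I" for j
    by (rule nonneg_bdd_above_summable_on)
      (auto simp: f_def intro!: bdd_aboveI2 parseval_sum_abs_le[OF e])
  have "(\<Sum>\<^sub>\<infinity>i\<in>I. \<bar>f (j, i)\<bar>) \<le> norm (a j) * norm (b j)" for j
    by (rule infsum_le_finite_sums[OF row_abs]) (auto simp: f_def intro!: parseval_sum_abs_le[OF e])
  moreover have "0 \<le> (\<Sum>\<^sub>\<infinity>i\<in>I. \<bar>f (j, i)\<bar>)" for j
    by (rule infsum_nonneg) simp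
  ultimately have "summable (\<lambda>j. \<Sum>\<^sub>\<infinity>i\<in>I. \<bar>f (j, i)\<bar>)"
    by (intro summable_comparison_test'[OF ab]) auto
  then have "(\<lambda>j. \<Sum>\<^sub>\<infinity>i\<in>I. \<bar>f (j, i)\<bar>) summable_on UNIV"
    by (subst summable_on_UNIV_nonneg_real_iff) (auto intro: infsum_nonneg)
  then have "(\<lambda>p. \<bar>f p\<bar>) summable_on UNIV \<times> I"
    by (intro summable_on_SigmaI[OF has_sum_infsum[OF row_abs]]) auto
  then have "f summable_on UNIV \<times> I"
    using summable_on_iff_abs_summable_on_real[of f] by simp
  then obtain u where u: "(f has_sum u) (UNIV \<times> I)"
    by (auto simp: summable_on_def)
  have "((\<lambda>j. a j \<bullet> b j) has_sum u) UNIV"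
    by (rule has_sum_SigmaD[OF u]) (simp add: f_def parseval_familyD[OF e])
  then have u_eq: "u = (\<Sum>j. a j \<bullet> b j)"
    by (intro sums_unique has_sum_imp_sums)
  have u': "((\<lambda>(i, j). f (j, i)) has_sum u) (I \<times> UNIV)"
    using u by (subst (asm) has_sum_swap)
  have "((\<lambda>i. A (e i) \<bullet> e i) has_sum u) I"
  proof (rule has_sum_SigmaD[OF u'])
    fix i assume "i \<in> I"
    then have "(\<lambda>j. (\<lambda>(i, j). f (j, i)) (i, j)) summable_on UNIV"
      using u' summable_on_SigmaD1[where f = "\<lambda>i j. f (j, i)" and A = I and B = "\<lambda>_. UNIV"]
      by (auto simp: summable_on_def)
    moreover have "(\<lambda>j. (\<lambda>(i, j). f (j, i)) (i, j)) sums (A (e i) \<bullet> e i)"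
      using bounded_linear.sums[OF bounded_linear_inner_left A[of "e i"], of "e i"]
      by (simp add: f_def inner_commute)
    ultimately show "((\<lambda>j. (\<lambda>(i, j). f (j, i)) (i, j)) has_sum (A (e i) \<bullet> e i)) UNIV"
      by (rule has_sum_if_summable_on_and_sums)
  qed
  then show ?thesis by (simp add: u_eq)
qed

lemma op_trace_nuclear:
  fixes A :: "'h::{real_inner, second_countable_topology} \<Rightarrow>\<^sub>L 'h"
  assumes "summable (\<lambda>j. norm (a j) * norm (b j))" "\<And>x. (\<lambda>j. (a j \<bullet> x) *\<^sub>R b j) sums A x"
  shows "op_trace A = (\<Sum>j. a j \<bullet> b j)"
  unfolding op_trace_def
proof (rule the_equality)
  show all: "\<forall>B. orthonormal_basis B \<longrightarrow> ((\<lambda>e. A e \<bullet> e) has_sum (\<Sum>j. a j \<bullet> b j)) B"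
    using nuclear_trace[OF orthonormal_basis_parseval assms] by blast
  fix t assume t: "\<forall>B. orthonormal_basis B \<longrightarrow> ((\<lambda>e. A e \<bullet> e) has_sum t) B"
  obtain B :: "'h set" where "orthonormal_basis B"
    using orthonormal_basis_exists_countable by blast
  then show "t = (\<Sum>j. a j \<bullet> b j)"
    using t all has_sum_unique by blast
qed

lemma op_trace_sums:
  fixes A :: "'h::{real_inner, second_countable_topology} \<Rightarrow>\<^sub>L 'h"
  assumes "trace_class A" "parseval_family UNIV (e :: nat \<Rightarrow> 'h)"
  shows "(\<lambda>i. A (e i) \<bullet> e i) sums op_trace A"
proof -
  obtain a b where ab: "summable (\<lambda>j. norm (a j) * norm (b j))" "\<And>x. (\<lambda>j. (a j \<bullet> x) *\<^sub>R b j) sums A x"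
    using assms(1) unfolding trace_class_def by blast
  show ?thesis
    unfolding op_trace_nuclear[OF ab]
    by (rule has_sum_imp_sums[OF nuclear_trace[OF assms(2) ab]])
qed

text \<open>
The vectors \<open>H a\<^sub>j\<close> and \<open>H b\<^sub>j\<close> represent \<open>H A H\<close>.
\<close>

lemma trace_class_congruence:
  assumes A: "trace_class A" and H: "H \<in> L_sym"
  shows "trace_class (H o\<^sub>L A o\<^sub>L H)"
proof -
  obtain a b where ab: "summable (\<lambda>j. norm (a j) * norm (b j))" "\<And>x. (\<lambda>j. (a j \<bullet> x) *\<^sub>R b j) sums A x"
    using A unfolding trace_class_def by blast
  show ?thesis
    unfolding trace_class_def
  proof (rule exI[of _ "\<lambda>j. H (a j)"], rule exI[of _ "\<lambda>j. H (b j)"], intro conjI allI)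
    have "norm (norm (H (a j)) * norm (H (b j))) \<le> (norm H)\<^sup>2 * (norm (a j) * norm (b j))" for j
    proof -
      have "norm (H (a j)) * norm (H (b j)) \<le> (norm H * norm (a j)) * (norm H * norm (b j))"
        by (intro mult_mono norm_blinfun) auto
      then show ?thesis by (simp add: power2_eq_square mult_ac)
    qed
    then show "summable (\<lambda>j. norm (H (a j)) * norm (H (b j)))"
      by (intro summable_comparison_test'[OF summable_mult[OF ab(1)]])
    fix x
    show "(\<lambda>j. (H (a j) \<bullet> x) *\<^sub>R H (b j)) sums (H o\<^sub>L A o\<^sub>L H) x"
      using bounded_linear.sums[OF blinfun.bounded_linear_right ab(2)[of "H x"], of H]
      by (simp add: blinfun.scaleR_right L_symD[OF H])
  qed
qed

text \<open>
Expanding \<open>S x\<close> in the basis gives the nuclear representation \<open>\<Sum>i. \<langle>S e\<^sub>i, x\<rangle> S H e\<^sub>i\<close>.  It is summable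
since \<open>(norm (S e\<^sub>i))\<^sup>2\<close> and \<open>(norm (S H e\<^sub>i))\<^sup>2\<close> are the diagonal entries of \<open>C\<close> and of \<open>H C H\<close>, which
are both of trace class.
\<close>

lemma op_sqrt_sandwich:
  fixes C H :: "'h::{real_inner, polish_space} \<Rightarrow>\<^sub>L 'h"
  assumes C: "C \<in> L_sym" "positive_op C" "trace_class C" and H: "H \<in> L_sym"
    and e: "parseval_family UNIV (e :: nat \<Rightarrow> 'h)"
  shows trace_class_op_sqrt_sandwich: "trace_class (op_sqrt C o\<^sub>L H o\<^sub>L op_sqrt C)"
    and op_trace_op_sqrt_sandwich: "(\<lambda>i. C (H (e i)) \<bullet> e i) sums op_trace (op_sqrt C o\<^sub>L H o\<^sub>L op_sqrt C)"
proof -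
  define S where "S = op_sqrt C"
  have S_sym: "S x \<bullet> y = x \<bullet> S y" and S_sq: "S (S x) = C x" for x y
    using op_sqrt_sym[OF C(1,2)] op_sqrt_square[OF C(1,2)] by (auto simp: S_def L_symD)
  let ?a = "\<lambda>i. S (e i)" and ?b = "\<lambda>i. S (H (e i))"
  have norm_S: "(norm (S x))\<^sup>2 = C x \<bullet> x" for x
    by (simp add: power2_norm_eq_inner S_sym S_sq inner_commute)
  have a: "summable (\<lambda>i. (norm (?a i))\<^sup>2)"
    unfolding norm_S by (rule sums_summable[OF op_trace_sums[OF C(3) e]])
  have b: "summable (\<lambda>i. (norm (?b i))\<^sup>2)"
    using sums_summable[OF op_trace_sums[OF trace_class_congruence[OF C(3) H] e]]
    unfolding norm_S by (simp add: L_symD[OF H])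
  have ab: "summable (\<lambda>i. norm (?a i) * norm (?b i))"
  proof (rule summable_comparison_test'[OF summable_add[OF a b]])
    fix i
    have "0 \<le> (norm (?a i) - norm (?b i))\<^sup>2" by simp
    then have "2 * (norm (?a i) * norm (?b i)) \<le> (norm (?a i))\<^sup>2 + (norm (?b i))\<^sup>2"
      by (simp add: power2_diff)
    moreover have "0 \<le> norm (?a i) * norm (?b i)" by simp
    ultimately show "norm (norm (?a i) * norm (?b i)) \<le> (norm (?a i))\<^sup>2 + (norm (?b i))\<^sup>2"
      unfolding real_norm_def by linarith
  qed
  have rep: "(\<lambda>i. (?a i \<bullet> x) *\<^sub>R ?b i) sums (S o\<^sub>L H o\<^sub>L S) x" for x
  proof -
    have "summable (\<lambda>i. norm ((?a i \<bullet> x) *\<^sub>R ?b i))"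
    proof (rule summable_comparison_test'[OF summable_mult2[OF ab, of "norm x"]])
      fix i
      have "\<bar>?a i \<bullet> x\<bar> * norm (?b i) \<le> (norm (?a i) * norm x) * norm (?b i)"
        by (intro mult_right_mono Cauchy_Schwarz_ineq2) auto
      then show "norm (norm ((?a i \<bullet> x) *\<^sub>R ?b i)) \<le> norm (?a i) * norm (?b i) * norm x"
        by (simp add: mult_ac)
    qed
    then have sums: "(\<lambda>i. (?a i \<bullet> x) *\<^sub>R ?b i) sums (\<Sum>i. (?a i \<bullet> x) *\<^sub>R ?b i)" (is "_ sums ?z")
      by (rule summable_sums[OF summable_if_norm_summable])
    \<comment> \<open>The series converges in norm, so its limit is determined by testing against vectors.\<close>
    have "?z \<bullet> y = S (H (S x)) \<bullet> y" for y
    proof -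
      have "(\<lambda>i. (e i \<bullet> S x) * (e i \<bullet> H (S y))) sums (?z \<bullet> y)"
        using bounded_linear.sums[OF bounded_linear_inner_left sums, of y]
        by (simp add: S_sym L_symD[OF H])
      then have "?z \<bullet> y = S x \<bullet> H (S y)"
        using parseval_sums[OF e] sums_unique2 by blast
      then show ?thesis by (simp add: S_sym L_symD[OF H])
    qed
    then have "?z = S (H (S x))" by (metis vector_eq_rdot)
    then show ?thesis using sums by simp
  qed
  show "trace_class (op_sqrt C o\<^sub>L H o\<^sub>L op_sqrt C)"
    unfolding trace_class_def S_def[symmetric]
    by (rule exI[of _ ?a], rule exI[of _ ?b]) (use ab rep in blast)
  have "summable (\<lambda>i. ?a i \<bullet> ?b i)"
    by (rule summable_comparison_test'[OF ab]) (simp add: Cauchy_Schwarz_ineq2)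
  then have "(\<lambda>i. ?a i \<bullet> ?b i) sums op_trace (S o\<^sub>L H o\<^sub>L S)"
    unfolding op_trace_nuclear[OF ab rep] by (rule summable_sums)
  moreover have "?a i \<bullet> ?b i = C (H (e i)) \<bullet> e i" for i
    unfolding S_sym[of "e i"] S_sq by (rule inner_commute)
  ultimately show "(\<lambda>i. C (H (e i)) \<bullet> e i) sums op_trace (op_sqrt C o\<^sub>L H o\<^sub>L op_sqrt C)"
    by (simp only: S_def)
qed

section \<open>Gaussian moments up to order four\<close>

lemma real_normal_central_moments:
  assumes "0 \<le> v"
  shows "has_bochner_integral (real_normal a v) (\<lambda>t. t - a) 0"
    and "has_bochner_integral (real_normal a v) (\<lambda>t. (t - a)\<^sup>2) v"
    and "has_bochner_integral (real_normal a v) (\<lambda>t. (t - a) ^ 3) 0"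
    and "has_bochner_integral (real_normal a v) (\<lambda>t. (t - a) ^ 4) (3 * v\<^sup>2)"
proof -
  have "has_bochner_integral (real_normal a v) (\<lambda>t. t - a) 0 \<and>
    has_bochner_integral (real_normal a v) (\<lambda>t. (t - a)\<^sup>2) v \<and>
    has_bochner_integral (real_normal a v) (\<lambda>t. (t - a) ^ 3) 0 \<and>
    has_bochner_integral (real_normal a v) (\<lambda>t. (t - a) ^ 4) (3 * v\<^sup>2)"
  proof (cases "v = 0")
    case True
    have "has_bochner_integral (return borel a) f (f a)" if "f \<in> borel_measurable borel" for f :: "real \<Rightarrow> real"
      using that
      by (auto simp: has_bochner_integral_iff integral_return integrable_iff_bounded nn_integral_return)
    from this[of "\<lambda>t. t - a"] this[of "\<lambda>t. (t - a)\<^sup>2"] this[of "\<lambda>t. (t - a) ^ 3"] this[of "\<lambda>t. (t - a) ^ 4"]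
    show ?thesis using True by (simp add: real_normal_def)
  next
    case False
    with assms have pos: "0 < sqrt v" by simp
    have density: "has_bochner_integral (real_normal a v) f y"
      if "has_bochner_integral lborel (\<lambda>t. normal_density a (sqrt v) t * f t) y" "f \<in> borel_measurable borel"
      for f :: "real \<Rightarrow> real" and y
      using that False
      by (simp add: real_normal_def has_bochner_integral_iff integrable_density integral_density)
    show ?thesis
      using normal_moment_odd[OF pos, of a 0] normal_moment_even[OF pos, of a 1]
        normal_moment_odd[OF pos, of a 1] normal_moment_even[OF pos, of a 2] assms False
      by (intro conjI density) (simp_all add: fact_numeral power2_eq_square)
  qed
  then show "has_bochner_integral (real_normal a v) (\<lambda>t. t - a) 0"
    "has_bochner_integral (real_normal a v) (\<lambda>t. (t - a)\<^sup>2) v"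
    "has_bochner_integral (real_normal a v) (\<lambda>t. (t - a) ^ 3) 0"
    "has_bochner_integral (real_normal a v) (\<lambda>t. (t - a) ^ 4) (3 * v\<^sup>2)"
    by blast+
qed

text \<open>
Summing powers of \<open>a \<plusminus> b \<plusminus> c\<close> with the product of the signs as weight kills every monomial in which \<open>b\<close>
or \<open>c\<close> has an even exponent, and leaves a multiple of \<open>a b c\<close>; likewise with four variables.
\<close>

lemma polarization_product3:
  fixes a b c :: real
  shows "a * b * c = (1/24) * ((a + b + c) ^ 3 - (a + b - c) ^ 3 - (a - b + c) ^ 3 + (a - b - c) ^ 3)"
proof -
  have "24 * (a * b * c) = (a + b + c) ^ 3 - (a + b - c) ^ 3 - (a - b + c) ^ 3 + (a - b - c) ^ 3"
    by algebra
  then show ?thesis by simp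
qed

lemma polarization_product4:
  fixes a b c d :: real
  shows "a * b * c * d = (1/192) *
    ((a + b + c + d) ^ 4 - (a + b + c - d) ^ 4 - (a + b - c + d) ^ 4 + (a + b - c - d) ^ 4
     - (a - b + c + d) ^ 4 + (a - b + c - d) ^ 4 + (a - b - c + d) ^ 4 - (a - b - c - d) ^ 4)"
proof -
  have "192 * (a * b * c * d) =
    (a + b + c + d) ^ 4 - (a + b + c - d) ^ 4 - (a + b - c + d) ^ 4 + (a + b - c - d) ^ 4
     - (a - b + c + d) ^ 4 + (a - b + c - d) ^ 4 + (a - b - c + d) ^ 4 - (a - b - c - d) ^ 4"
    by algebra
  then show ?thesis by simp
qed

text \<open>
The same sum of signs for the squares of a quadratic form at \<open>u \<plusminus> v \<plusminus> w \<plusminus> z\<close>.  The variables stand for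
the values of the bilinear form (\<open>uv\<close> at \<open>u\<close> and \<open>v\<close>), and the three pairings appear.
\<close>

lemma polarization_quadratic_form_squared:
  fixes uu vv ww zz uv uw uz vw vz wz :: real
  defines "q \<equiv> \<lambda>r s t. uu + vv + ww + zz + 2 * (r * uv + s * uw + t * uz + r * s * vw + r * t * vz + s * t * wz)"
  shows "(q 1 1 1)\<^sup>2 - (q 1 1 (-1))\<^sup>2 - (q 1 (-1) 1)\<^sup>2 + (q 1 (-1) (-1))\<^sup>2
     - (q (-1) 1 1)\<^sup>2 + (q (-1) 1 (-1))\<^sup>2 + (q (-1) (-1) 1)\<^sup>2 - (q (-1) (-1) (-1))\<^sup>2
     = 64 * (uv * wz + uw * vz + uz * vw)"
  unfolding q_def by algebra

locale hilbert_gaussian =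
  fixes \<mu> :: "'h::{real_inner, polish_space} measure" and m :: 'h and C :: "'h \<Rightarrow>\<^sub>L 'h"
  assumes gaussian: "is_gaussian \<mu> m C"
    and C_sym: "C \<in> L_sym" and C_pos: "positive_op C" and C_trace: "trace_class C"
begin

sublocale prob_space \<mu>
  using gaussian by (simp add: is_gaussian_def gaussian_measure_def)

lemma measurable_if_continuous:
  fixes f :: "'h \<Rightarrow> real"
  assumes "continuous_on UNIV f"
  shows "f \<in> borel_measurable \<mu>"
proof -
  have "sets \<mu> = sets borel" using gaussian by (simp add: is_gaussian_def gaussian_measure_def)
  then show ?thesis
    using borel_measurable_continuous_onI[OF assms] measurable_cong_sets by blast
qed

text \<open>
The parameters of the one-dimensional law are identified from the mean and covariance of \<open>\<mu>\<close>.
\<close>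

lemma linear_moments:
  shows moment1: "has_bochner_integral \<mu> (\<lambda>x. u \<bullet> (x - m)) 0"
    and moment2_diag: "has_bochner_integral \<mu> (\<lambda>x. (u \<bullet> (x - m))\<^sup>2) (C u \<bullet> u)"
    and moment3_diag: "has_bochner_integral \<mu> (\<lambda>x. (u \<bullet> (x - m)) ^ 3) 0"
    and moment4_diag: "has_bochner_integral \<mu> (\<lambda>x. (u \<bullet> (x - m)) ^ 4) (3 * (C u \<bullet> u)\<^sup>2)"
proof -
  obtain a v where v: "0 \<le> v" and distr: "distr \<mu> borel (\<lambda>x. u \<bullet> x) = real_normal a v"
    using gaussian unfolding is_gaussian_def gaussian_measure_def by blast
  have meas: "(\<lambda>x. u \<bullet> x) \<in> borel_measurable \<mu>"
    by (intro measurable_if_continuous continuous_intros)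
  have transfer: "has_bochner_integral \<mu> (\<lambda>x. f (u \<bullet> x)) y"
    if "has_bochner_integral (real_normal a v) f y" "f \<in> borel_measurable borel" for f :: "real \<Rightarrow> real" and y
    using that meas unfolding distr[symmetric]
    by (simp add: has_bochner_integral_iff integrable_distr_eq integral_distr)
  have 1: "has_bochner_integral \<mu> (\<lambda>x. u \<bullet> x - a) 0"
    by (rule transfer[OF real_normal_central_moments(1)[OF v]]) simp
  have "has_bochner_integral \<mu> (\<lambda>x. (u \<bullet> x - a) + a) (0 + a)"
    by (intro has_bochner_integral_add 1) (simp add: has_bochner_integral_iff prob_space)
  moreover have "(\<integral>x. u \<bullet> x \<partial>\<mu>) = u \<bullet> m"
    using gaussian by (simp add: is_gaussian_def has_mean_def)
  ultimately have a: "u \<bullet> x - a = u \<bullet> (x - m)" for x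
    by (simp add: has_bochner_integral_iff inner_diff_right)
  have 2: "has_bochner_integral \<mu> (\<lambda>x. (u \<bullet> (x - m))\<^sup>2) v"
    using transfer[OF real_normal_central_moments(2)[OF v]] by (simp add: a)
  moreover have "(\<integral>x. (u \<bullet> (x - m))\<^sup>2 \<partial>\<mu>) = C u \<bullet> u"
    using gaussian by (simp add: is_gaussian_def has_covariance_def power2_eq_square)
  ultimately have v_eq: "v = C u \<bullet> u" by (simp add: has_bochner_integral_iff)
  show "has_bochner_integral \<mu> (\<lambda>x. u \<bullet> (x - m)) 0" using 1 by (simp add: a)
  show "has_bochner_integral \<mu> (\<lambda>x. (u \<bullet> (x - m))\<^sup>2) (C u \<bullet> u)" using 2 v_eq by simp
  show "has_bochner_integral \<mu> (\<lambda>x. (u \<bullet> (x - m)) ^ 3) 0"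
    using transfer[OF real_normal_central_moments(3)[OF v]] by (simp add: a)
  show "has_bochner_integral \<mu> (\<lambda>x. (u \<bullet> (x - m)) ^ 4) (3 * (C u \<bullet> u)\<^sup>2)"
    using transfer[OF real_normal_central_moments(4)[OF v]] by (simp add: a v_eq)
qed

lemma moment2: "has_bochner_integral \<mu> (\<lambda>x. (u \<bullet> (x - m)) * (v \<bullet> (x - m))) (C u \<bullet> v)"
proof -
  have "has_bochner_integral \<mu> (\<lambda>x. (1/4) * (((u + v) \<bullet> (x - m))\<^sup>2 - ((u - v) \<bullet> (x - m))\<^sup>2))
     ((1/4) * (C (u + v) \<bullet> (u + v) - C (u - v) \<bullet> (u - v)))"
    by (intro has_bochner_integral_mult_right has_bochner_integral_diff moment2_diag)
  moreover have "(1/4) * (((u + v) \<bullet> y)\<^sup>2 - ((u - v) \<bullet> y)\<^sup>2) = (u \<bullet> y) * (v \<bullet> y)" for y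
    by (simp add: inner_add_left inner_diff_left power2_eq_square algebra_simps)
  moreover have "(1/4) * (C (u + v) \<bullet> (u + v) - C (u - v) \<bullet> (u - v)) = C u \<bullet> v"
    using L_symD[OF C_sym, of v u]
    by (simp add: blinfun.add_right blinfun.diff_right inner_add_left inner_add_right
        inner_diff_left inner_diff_right inner_commute)
  ultimately show ?thesis by simp
qed

lemma moment3: "has_bochner_integral \<mu> (\<lambda>x. (u \<bullet> (x - m)) * (v \<bullet> (x - m)) * (w \<bullet> (x - m))) 0"
proof -
  have "has_bochner_integral \<mu>
     (\<lambda>x. (1/24) * (((u + v + w) \<bullet> (x - m)) ^ 3 - ((u + v - w) \<bullet> (x - m)) ^ 3
        - ((u - v + w) \<bullet> (x - m)) ^ 3 + ((u - v - w) \<bullet> (x - m)) ^ 3))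
     ((1/24) * (0 - 0 - 0 + 0))"
    by (intro has_bochner_integral_mult_right has_bochner_integral_diff has_bochner_integral_add moment3_diag)
  then show ?thesis
    unfolding inner_add_left inner_diff_left polarization_product3[symmetric] by simp
qed

lemma moment4:
  "has_bochner_integral \<mu> (\<lambda>x. (u \<bullet> (x - m)) * (v \<bullet> (x - m)) * (w \<bullet> (x - m)) * (z \<bullet> (x - m)))
    ((C u \<bullet> v) * (C w \<bullet> z) + (C u \<bullet> w) * (C v \<bullet> z) + (C u \<bullet> z) * (C v \<bullet> w))"
proof -
  define q where "q = (\<lambda>r s t. C (u + r *\<^sub>R v + s *\<^sub>R w + t *\<^sub>R z) \<bullet> (u + r *\<^sub>R v + s *\<^sub>R w + t *\<^sub>R z))"
  define M where "M = (\<lambda>r s t x. ((u + r *\<^sub>R v + s *\<^sub>R w + t *\<^sub>R z) \<bullet> (x - m)) ^ 4)"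
  have M: "has_bochner_integral \<mu> (M r s t) (3 * (q r s t)\<^sup>2)" for r s t
    unfolding M_def q_def by (rule moment4_diag)
  have int: "has_bochner_integral \<mu>
    (\<lambda>x. (1/192) * (M 1 1 1 x - M 1 1 (-1) x - M 1 (-1) 1 x + M 1 (-1) (-1) x
      - M (-1) 1 1 x + M (-1) 1 (-1) x + M (-1) (-1) 1 x - M (-1) (-1) (-1) x))
    ((1/192) * (3 * (q 1 1 1)\<^sup>2 - 3 * (q 1 1 (-1))\<^sup>2 - 3 * (q 1 (-1) 1)\<^sup>2 + 3 * (q 1 (-1) (-1))\<^sup>2
      - 3 * (q (-1) 1 1)\<^sup>2 + 3 * (q (-1) 1 (-1))\<^sup>2 + 3 * (q (-1) (-1) 1)\<^sup>2 - 3 * (q (-1) (-1) (-1))\<^sup>2))"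
    by (intro has_bochner_integral_mult_right has_bochner_integral_diff has_bochner_integral_add M)
  have fn: "(1/192) * (M 1 1 1 x - M 1 1 (-1) x - M 1 (-1) 1 x + M 1 (-1) (-1) x
      - M (-1) 1 1 x + M (-1) 1 (-1) x + M (-1) (-1) 1 x - M (-1) (-1) (-1) x)
    = (u \<bullet> (x - m)) * (v \<bullet> (x - m)) * (w \<bullet> (x - m)) * (z \<bullet> (x - m))" for x
    unfolding polarization_product4 M_def by (simp add: inner_add_left inner_diff_left)
  have C_comm: "C y \<bullet> x = C x \<bullet> y" for x y
    by (metis L_symD[OF C_sym] inner_commute)
  have q: "q r s t = C u \<bullet> u + r\<^sup>2 * (C v \<bullet> v) + s\<^sup>2 * (C w \<bullet> w) + t\<^sup>2 * (C z \<bullet> z)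
      + 2 * (r * (C u \<bullet> v) + s * (C u \<bullet> w) + t * (C u \<bullet> z)
        + r * s * (C v \<bullet> w) + r * t * (C v \<bullet> z) + s * t * (C w \<bullet> z))" for r s t
    unfolding q_def
    by (simp add: blinfun.add_right blinfun.scaleR_right inner_add_left inner_add_right
        C_comm[of v u] C_comm[of w u] C_comm[of z u] C_comm[of w v] C_comm[of z v] C_comm[of z w]
        power2_eq_square algebra_simps)
  have val: "(1/192) * (3 * (q 1 1 1)\<^sup>2 - 3 * (q 1 1 (-1))\<^sup>2 - 3 * (q 1 (-1) 1)\<^sup>2 + 3 * (q 1 (-1) (-1))\<^sup>2
      - 3 * (q (-1) 1 1)\<^sup>2 + 3 * (q (-1) 1 (-1))\<^sup>2 + 3 * (q (-1) (-1) 1)\<^sup>2 - 3 * (q (-1) (-1) (-1))\<^sup>2)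
    = (C u \<bullet> v) * (C w \<bullet> z) + (C u \<bullet> w) * (C v \<bullet> z) + (C u \<bullet> z) * (C v \<bullet> w)"
    using polarization_quadratic_form_squared[of "C u \<bullet> u" "C v \<bullet> v" "C w \<bullet> w" "C z \<bullet> z"
        "C u \<bullet> v" "C u \<bullet> w" "C u \<bullet> z" "C v \<bullet> w" "C v \<bullet> z" "C w \<bullet> z"]
    unfolding q by simp
  show ?thesis using int unfolding fn val .
qed

text \<open>
The expectation of the square of a partial sum of \<open>\<Sum>i. \<langle>e\<^sub>i, X\<rangle>\<^sup>2\<close> is at most three times the square of
the trace of \<open>C\<close>, by \<open>moment4\<close> and the Cauchy-Schwarz inequality for \<open>C\<close>; then monotone convergence
applies.
\<close>

lemma integrable_norm_power4: "integrable \<mu> (\<lambda>x. norm (x - m) ^ 4)"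
proof -
  obtain e :: "nat \<Rightarrow> 'h" where e: "parseval_family UNIV e"
    using parseval_sequence_exists by blast
  let ?c = "\<lambda>i. C (e i) \<bullet> e i"
  have c_nonneg: "0 \<le> ?c i" for i by (rule positive_opD[OF C_pos])
  have c_sum: "summable ?c" by (rule sums_summable[OF op_trace_sums[OF C_trace e]])
  define f where "f = (\<lambda>n x. (\<Sum>i<n. (e i \<bullet> (x - m))\<^sup>2)\<^sup>2)"
  have f_eq: "f n x = (\<Sum>i<n. \<Sum>j<n. (e i \<bullet> (x - m)) * (e i \<bullet> (x - m)) * (e j \<bullet> (x - m)) * (e j \<bullet> (x - m)))" for n x
    by (simp add: f_def power2_eq_square sum_product mult.assoc)
  have f_int: "has_bochner_integral \<mu> (f n) (\<Sum>i<n. \<Sum>j<n. ?c i * ?c j + (C (e i) \<bullet> e j) * (C (e i) \<bullet> e j) + (C (e i) \<bullet> e j) * (C (e i) \<bullet> e j))" for n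
    unfolding f_eq by (intro has_bochner_integral_sum moment4)
  have "(C (e i) \<bullet> e j) * (C (e i) \<bullet> e j) \<le> ?c i * ?c j" for i j
    using positive_form_Cauchy_Schwarz[OF C_sym C_pos] by (simp add: power2_eq_square)
  then have "(\<Sum>i<n. \<Sum>j<n. ?c i * ?c j + (C (e i) \<bullet> e j) * (C (e i) \<bullet> e j) + (C (e i) \<bullet> e j) * (C (e i) \<bullet> e j))
      \<le> (\<Sum>i<n. \<Sum>j<n. 3 * (?c i * ?c j))" for n
    by (intro sum_mono) (smt (verit))
  also have "(\<Sum>i<n. \<Sum>j<n. 3 * (?c i * ?c j)) = 3 * (\<Sum>i<n. ?c i)\<^sup>2" for n
    by (simp add: power2_eq_square sum_product flip: sum_distrib_left)
  also have "3 * (\<Sum>i<n. ?c i)\<^sup>2 \<le> 3 * (\<Sum>i. ?c i)\<^sup>2" for n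
    by (intro mult_left_mono power_mono sum_le_suminf c_sum sum_nonneg) (auto intro: c_nonneg)
  finally have f_bound: "integral\<^sup>L \<mu> (f n) \<le> 3 * (\<Sum>i. ?c i)\<^sup>2" for n
    using f_int[of n] by (simp add: has_bochner_integral_iff)
  have f_mono: "mono (\<lambda>n. f n x)" for x
    unfolding f_def by (intro monoI power_mono sum_mono2 sum_nonneg) auto
  have "incseq (\<lambda>n. integral\<^sup>L \<mu> (f n))"
    using f_int f_mono by (intro monoI integral_mono) (auto simp: has_bochner_integral_iff mono_def)
  then obtain L where L: "(\<lambda>n. integral\<^sup>L \<mu> (f n)) \<longlonglongrightarrow> L"
    using incseq_convergent[of "\<lambda>n. integral\<^sup>L \<mu> (f n)"] f_bound by metis
  show ?thesis
  proof (rule integrable_monotone_convergence[OF _ _ _ L])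
    show "integrable \<mu> (f n)" for n using f_int by (simp add: has_bochner_integral_iff)
    show "AE x in \<mu>. mono (\<lambda>n. f n x)" using f_mono by simp
    have "(\<lambda>n. f n x) \<longlonglongrightarrow> ((norm (x - m))\<^sup>2)\<^sup>2" for x
      using parseval_sums[OF e, of "x - m" "x - m"] unfolding f_def sums_def
      by (intro tendsto_power) (simp only: power2_norm_eq_inner, simp only: power2_eq_square)
    then show "AE x in \<mu>. (\<lambda>n. f n x) \<longlonglongrightarrow> norm (x - m) ^ 4" by simp
    show "(\<lambda>x. norm (x - m) ^ 4) \<in> borel_measurable \<mu>"
      by (intro measurable_if_continuous continuous_intros)
  qed
qed

lemma integrable_norm_power:
  assumes "k \<le> 4"
  shows "integrable \<mu> (\<lambda>x. norm (x - m) ^ k)"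
proof (rule Bochner_Integration.integrable_bound)
  show "integrable \<mu> (\<lambda>x. 1 + norm (x - m) ^ 4)"
    using integrable_norm_power4 by simp
  show "(\<lambda>x. norm (x - m) ^ k) \<in> borel_measurable \<mu>"
    by (intro measurable_if_continuous continuous_intros)
  have "t ^ k \<le> 1 + t ^ 4" if "0 \<le> t" for t :: real
  proof (cases "t \<le> 1")
    case True
    then have "t ^ k \<le> 1" using that by (simp add: power_le_one)
    then show ?thesis using that by (simp add: add_increasing2)
  next
    case False
    then have "t ^ k \<le> t ^ 4" using assms by (intro power_increasing) auto
    then show ?thesis by simp
  qed
  then show "AE x in \<mu>. norm (norm (x - m) ^ k) \<le> norm (1 + norm (x - m) ^ 4)"
    by (auto intro!: AE_I2)
qed

text \<open>
By Bessel's inequality, the partial sums of the basis expansion of \<open>\<langle>H X, X\<rangle>\<close> are bounded by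
\<open>norm H * (norm X)\<^sup>2\<close>, so the moment of order \<open>k + 2 \<le> 4\<close> of the norm
is what dominated convergence needs.
\<close>

lemma quadratic_form_expansion:
  fixes e :: "nat \<Rightarrow> 'h" and W :: "'h \<Rightarrow> real"
  assumes e: "parseval_family UNIV e" and H: "H \<in> L_sym"
    and W: "W \<in> borel_measurable \<mu>" "\<And>x. \<bar>W x\<bar> \<le> c * norm (x - m) ^ k" and k: "k \<le> 2"
  shows integrable_times_quadratic_form: "integrable \<mu> (\<lambda>x. W x * (H (x - m) \<bullet> (x - m)))"
    and integral_times_quadratic_form_sums:
      "(\<lambda>i. \<integral>x. W x * ((H (e i) \<bullet> (x - m)) * (e i \<bullet> (x - m))) \<partial>\<mu>) sums
        (\<integral>x. W x * (H (x - m) \<bullet> (x - m)) \<partial>\<mu>)"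
proof -
  let ?t = "\<lambda>i x. (e i \<bullet> H (x - m)) * (e i \<bullet> (x - m))"
  let ?w = "\<lambda>x. (c * norm H) * norm (x - m) ^ (k + 2)"
  have w: "integrable \<mu> ?w"
    using integrable_norm_power[of "k + 2"] k by simp
  have partial: "\<bar>W x * (\<Sum>i\<in>F. ?t i x)\<bar> \<le> ?w x" if "finite F" for F x
  proof -
    have "\<bar>\<Sum>i\<in>F. ?t i x\<bar> \<le> norm (H (x - m)) * norm (x - m)"
      by (rule order_trans[OF sum_abs parseval_sum_abs_le[OF e that]]) simp
    also have "\<dots> \<le> (norm H * norm (x - m)) * norm (x - m)"
      by (intro mult_right_mono norm_blinfun) auto
    finally have "\<bar>\<Sum>i\<in>F. ?t i x\<bar> \<le> norm H * (norm (x - m))\<^sup>2"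
      by (simp add: power2_eq_square)
    then have "\<bar>W x\<bar> * \<bar>\<Sum>i\<in>F. ?t i x\<bar> \<le> (c * norm (x - m) ^ k) * (norm H * (norm (x - m))\<^sup>2)"
      using W(2)[of x] by (intro mult_mono) auto
    then show ?thesis by (simp add: abs_mult power_add power2_eq_square mult_ac)
  qed
  have meas: "(\<lambda>x. W x * (\<Sum>i\<in>F. ?t i x)) \<in> borel_measurable \<mu>" for F
    by (intro borel_measurable_times W(1) measurable_if_continuous continuous_intros)
  have int: "integrable \<mu> (\<lambda>x. W x * (\<Sum>i\<in>F. ?t i x))" if "finite F" for F
    by (rule Bochner_Integration.integrable_bound[OF w meas])
      (use partial[OF that] in \<open>auto intro!: AE_I2 intro: order_trans[OF _ abs_ge_self]\<close>)
  have lim: "(\<lambda>n. W x * (\<Sum>i<n. ?t i x)) \<longlonglongrightarrow> W x * (H (x - m) \<bullet> (x - m))" for x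
    using parseval_sums[OF e, of "H (x - m)" "x - m"] unfolding sums_def by (rule tendsto_mult_left)
  have meas': "(\<lambda>x. W x * (H (x - m) \<bullet> (x - m))) \<in> borel_measurable \<mu>"
    by (intro borel_measurable_times W(1) measurable_if_continuous continuous_intros)
  have dominated: "AE x in \<mu>. norm (W x * (\<Sum>i<n. ?t i x)) \<le> ?w x" for n
    by (rule AE_I2) (simp only: real_norm_def partial finite_lessThan)
  note dct = meas' meas[of "{..<n}" for n] w AE_I2[OF lim]
  show "integrable \<mu> (\<lambda>x. W x * (H (x - m) \<bullet> (x - m)))"
    by (rule integrable_dominated_convergence[OF dct dominated])
  have term_int: "integrable \<mu> (\<lambda>x. W x * ?t i x)" for i
    using int[of "{i}"] by simp
  have "(\<lambda>n. \<integral>x. W x * (\<Sum>i<n. ?t i x) \<partial>\<mu>) \<longlonglongrightarrow> (\<integral>x. W x * (H (x - m) \<bullet> (x - m)) \<partial>\<mu>)"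
    by (rule integral_dominated_convergence[OF dct dominated])
  moreover have "(\<integral>x. W x * (\<Sum>i<n. ?t i x) \<partial>\<mu>) = (\<Sum>i<n. \<integral>x. W x * ?t i x \<partial>\<mu>)" for n
    unfolding sum_distrib_left by (rule Bochner_Integration.integral_sum) (rule term_int)
  ultimately show "(\<lambda>i. \<integral>x. W x * ((H (e i) \<bullet> (x - m)) * (e i \<bullet> (x - m))) \<partial>\<mu>) sums
        (\<integral>x. W x * (H (x - m) \<bullet> (x - m)) \<partial>\<mu>)"
    by (simp add: sums_def L_symD[OF H])
qed

section \<open>Moments of a quadratic form\<close>

context
  fixes H :: "'h \<Rightarrow>\<^sub>L 'h"
  assumes H: "H \<in> L_sym"
begin

abbreviation Q :: "'h \<Rightarrow> real" where "Q x \<equiv> H (x - m) \<bullet> (x - m)"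

abbreviation T :: real where "T \<equiv> op_trace (op_sqrt C o\<^sub>L H o\<^sub>L op_sqrt C)"

lemma expectation_quadratic_form: "has_bochner_integral \<mu> Q T"
proof -
  obtain e :: "nat \<Rightarrow> 'h" where e: "parseval_family UNIV e"
    using parseval_sequence_exists by blast
  have "integrable \<mu> (\<lambda>x. 1 * Q x)"
    and "(\<lambda>i. \<integral>x. 1 * ((H (e i) \<bullet> (x - m)) * (e i \<bullet> (x - m))) \<partial>\<mu>) sums (\<integral>x. 1 * Q x \<partial>\<mu>)"
    using integrable_times_quadratic_form[OF e H, where W = "\<lambda>_. 1" and c = 1 and k = 0]
      integral_times_quadratic_form_sums[OF e H, where W = "\<lambda>_. 1" and c = 1 and k = 0] by simp_all
  moreover have "(\<integral>x. 1 * ((H (e i) \<bullet> (x - m)) * (e i \<bullet> (x - m))) \<partial>\<mu>) = C (H (e i)) \<bullet> e i" for i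
    using moment2 by (simp add: has_bochner_integral_iff)
  ultimately have "integrable \<mu> Q" "(\<lambda>i. C (H (e i)) \<bullet> e i) sums (\<integral>x. Q x \<partial>\<mu>)"
    by simp_all
  then show ?thesis
    using op_trace_op_sqrt_sandwich[OF C_sym C_pos C_trace H e] sums_unique2
    by (auto simp: has_bochner_integral_iff)
qed

lemma expectation_linear_times_quadratic_form:
  "has_bochner_integral \<mu> (\<lambda>x. (u \<bullet> (x - m)) * Q x) 0"
proof -
  obtain e :: "nat \<Rightarrow> 'h" where e: "parseval_family UNIV e"
    using parseval_sequence_exists by blast
  have W: "(\<lambda>x. u \<bullet> (x - m)) \<in> borel_measurable \<mu>" "\<And>x. \<bar>u \<bullet> (x - m)\<bar> \<le> norm u * norm (x - m) ^ 1"
    by (auto intro!: measurable_if_continuous continuous_intros simp: Cauchy_Schwarz_ineq2)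
  have "(\<integral>x. (u \<bullet> (x - m)) * ((H (e i) \<bullet> (x - m)) * (e i \<bullet> (x - m))) \<partial>\<mu>) = 0" for i
    using moment3[of u "H (e i)" "e i"] by (simp add: has_bochner_integral_iff mult.assoc)
  then have "(\<integral>x. (u \<bullet> (x - m)) * Q x \<partial>\<mu>) = 0"
    using integral_times_quadratic_form_sums[OF e H W] by (simp add: sums_iff)
  then show ?thesis
    using integrable_times_quadratic_form[OF e H W] by (simp add: has_bochner_integral_iff)
qed

text \<open>
The three pairings of \<open>u\<close>, \<open>v\<close>, \<open>H e\<^sub>i\<close>, \<open>e\<^sub>i\<close> give three series: one is a multiple of the trace, and
Parseval evaluates the other two, which agree because \<open>H\<close> is symmetric.
\<close>

lemma expectation_product_times_quadratic_form:
  "has_bochner_integral \<mu> (\<lambda>x. ((u \<bullet> (x - m)) * (v \<bullet> (x - m))) * Q x)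
    (T * (C u \<bullet> v) + 2 * (H (C u) \<bullet> C v))"
proof -
  obtain e :: "nat \<Rightarrow> 'h" where e: "parseval_family UNIV e"
    using parseval_sequence_exists by blast
  have meas: "(\<lambda>x. (u \<bullet> (x - m)) * (v \<bullet> (x - m))) \<in> borel_measurable \<mu>"
    by (intro measurable_if_continuous continuous_intros)
  have bound: "\<bar>(u \<bullet> (x - m)) * (v \<bullet> (x - m))\<bar> \<le> (norm u * norm v) * norm (x - m) ^ 2" for x
  proof -
    have "\<bar>u \<bullet> (x - m)\<bar> * \<bar>v \<bullet> (x - m)\<bar> \<le> (norm u * norm (x - m)) * (norm v * norm (x - m))"
      by (intro mult_mono Cauchy_Schwarz_ineq2) auto
    then show ?thesis by (simp add: abs_mult power2_eq_square mult_ac)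
  qed
  have C_comm: "C y \<bullet> x = C x \<bullet> y" for x y
    by (metis L_symD[OF C_sym] inner_commute)
  have "(\<integral>x. ((u \<bullet> (x - m)) * (v \<bullet> (x - m))) * ((H (e i) \<bullet> (x - m)) * (e i \<bullet> (x - m))) \<partial>\<mu>)
      = (C u \<bullet> v) * (C (H (e i)) \<bullet> e i) + (e i \<bullet> H (C u)) * (e i \<bullet> C v) + (e i \<bullet> C u) * (e i \<bullet> H (C v))" for i
    using moment4[of u v "H (e i)" "e i"] L_symD[OF H, of "e i"]
    by (simp add: has_bochner_integral_iff mult.assoc inner_commute[of "C _"])
  moreover have "(\<lambda>i. (C u \<bullet> v) * (C (H (e i)) \<bullet> e i) + (e i \<bullet> H (C u)) * (e i \<bullet> C v) + (e i \<bullet> C u) * (e i \<bullet> H (C v)))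
      sums ((C u \<bullet> v) * T + H (C u) \<bullet> C v + C u \<bullet> H (C v))"
    by (intro sums_add sums_mult parseval_sums[OF e] op_trace_op_sqrt_sandwich[OF C_sym C_pos C_trace H e])
  ultimately have "(\<integral>x. ((u \<bullet> (x - m)) * (v \<bullet> (x - m))) * Q x \<partial>\<mu>)
      = (C u \<bullet> v) * T + H (C u) \<bullet> C v + C u \<bullet> H (C v)"
    using integral_times_quadratic_form_sums[OF e H meas bound] sums_unique2 by simp
  also have "\<dots> = T * (C u \<bullet> v) + 2 * (H (C u) \<bullet> C v)"
    by (simp add: L_symD[OF H] mult.commute)
  finally show ?thesis
    using integrable_times_quadratic_form[OF e H meas bound] by (simp add: has_bochner_integral_iff)
qed

lemma op_sqrt_sandwich_square:
  fixes S :: "'h \<Rightarrow>\<^sub>L 'h"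
  defines "S \<equiv> op_sqrt C"
  shows "(S o\<^sub>L H o\<^sub>L S) o\<^sub>L (S o\<^sub>L H o\<^sub>L S) = S o\<^sub>L (H o\<^sub>L C o\<^sub>L H) o\<^sub>L S"
  by (rule blinfun_eqI) (simp add: S_def op_sqrt_square[OF C_sym C_pos])

lemma congruence_sym: "H o\<^sub>L C o\<^sub>L H \<in> L_sym"
  by (simp add: L_sym_def L_symD[OF H] L_symD[OF C_sym])

abbreviation R :: real where
  "R \<equiv> op_trace ((op_sqrt C o\<^sub>L H o\<^sub>L op_sqrt C) o\<^sub>L (op_sqrt C o\<^sub>L H o\<^sub>L op_sqrt C))"

text \<open>
Expanding one of the two factors reduces to the previous expectation with \<open>u = H e\<^sub>i\<close>, \<open>v = e\<^sub>i\<close>, whose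
second term is twice the \<open>i\<close>-th diagonal entry of \<open>C (H C H)\<close>.
\<close>

lemma expectation_quadratic_form_square: "has_bochner_integral \<mu> (\<lambda>x. Q x * Q x) (T\<^sup>2 + 2 * R)"
proof -
  obtain e :: "nat \<Rightarrow> 'h" where e: "parseval_family UNIV e"
    using parseval_sequence_exists by blast
  have meas: "Q \<in> borel_measurable \<mu>"
    by (intro measurable_if_continuous continuous_intros)
  have bound: "\<bar>Q x\<bar> \<le> norm H * norm (x - m) ^ 2" for x
  proof -
    have "\<bar>Q x\<bar> \<le> norm (H (x - m)) * norm (x - m)" by (rule Cauchy_Schwarz_ineq2)
    also have "\<dots> \<le> (norm H * norm (x - m)) * norm (x - m)"
      by (intro mult_right_mono norm_blinfun) auto
    finally show ?thesis by (simp add: power2_eq_square)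
  qed
  have "(\<integral>x. Q x * ((H (e i) \<bullet> (x - m)) * (e i \<bullet> (x - m))) \<partial>\<mu>)
      = T * (C (H (e i)) \<bullet> e i) + 2 * (C ((H o\<^sub>L C o\<^sub>L H) (e i)) \<bullet> e i)" for i
    using expectation_product_times_quadratic_form[of "H (e i)" "e i"]
    by (simp add: has_bochner_integral_iff mult.commute L_symD[OF C_sym])
  moreover have "(\<lambda>i. T * (C (H (e i)) \<bullet> e i) + 2 * (C ((H o\<^sub>L C o\<^sub>L H) (e i)) \<bullet> e i)) sums (T * T + 2 * R)"
    unfolding op_sqrt_sandwich_square
    by (intro sums_add sums_mult op_trace_op_sqrt_sandwich[OF C_sym C_pos C_trace _ e] H congruence_sym)
  ultimately have "(\<integral>x. Q x * Q x \<partial>\<mu>) = T\<^sup>2 + 2 * R"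
    using integral_times_quadratic_form_sums[OF e H meas bound] sums_unique2 by (simp add: power2_eq_square)
  then show ?thesis
    using integrable_times_quadratic_form[OF e H meas bound] by (simp add: has_bochner_integral_iff)
qed

lemma expectation_quadratic_polynomial:
  "has_bochner_integral \<mu> (\<lambda>x. a + g \<bullet> (x - m) + 1/2 * Q x) (a + 1/2 * T)"
proof -
  have "has_bochner_integral \<mu> (\<lambda>x. a + g \<bullet> (x - m) + 1/2 * Q x) (a + 0 + 1/2 * T)"
    by (intro has_bochner_integral_add has_bochner_integral_mult_right moment1 expectation_quadratic_form)
      (simp add: has_bochner_integral_iff prob_space)
  then show ?thesis by simp
qed

lemma variance_quadratic_polynomial:
  "has_bochner_integral \<mu> (\<lambda>x. ((a + g \<bullet> (x - m) + 1/2 * Q x) - (a + 1/2 * T))\<^sup>2) (C g \<bullet> g + 1/2 * R)"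
proof -
  have const: "has_bochner_integral \<mu> (\<lambda>_. c) c" for c :: real
    by (simp add: has_bochner_integral_iff prob_space)
  have int: "has_bochner_integral \<mu>
     (\<lambda>x. (g \<bullet> (x - m))\<^sup>2 + (g \<bullet> (x - m)) * Q x - T * (g \<bullet> (x - m))
        + (1/4) * (Q x * Q x) - (T/2) * Q x + T\<^sup>2/4)
     (C g \<bullet> g + 0 - T * 0 + (1/4) * (T\<^sup>2 + 2 * R) - (T/2) * T + T\<^sup>2/4)"
    by (intro has_bochner_integral_add has_bochner_integral_diff has_bochner_integral_mult_right
        moment1 moment2_diag expectation_linear_times_quadratic_form expectation_quadratic_form
        expectation_quadratic_form_square const)
  have square: "s\<^sup>2 + s * t - T * s + (1/4) * (t * t) - (T/2) * t + T\<^sup>2/4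
      = ((a + s + 1/2 * t) - (a + 1/2 * T))\<^sup>2" for s t
    by (simp add: power2_eq_square field_simps)
  have val: "C g \<bullet> g + 0 - T * 0 + (1/4) * (T\<^sup>2 + 2 * R) - (T/2) * T + T\<^sup>2/4 = C g \<bullet> g + 1/2 * R"
    by (simp add: power2_eq_square field_simps)
  show ?thesis using int unfolding square val .
qed

end

end

theorem proposition3p2:
  fixes \<mu> :: "'h::{real_inner, polish_space} measure"
    and mbar g :: 'h
    and C H :: "'h \<Rightarrow>\<^sub>L 'h"
    and \<Theta> \<Theta>quad :: "'h \<Rightarrow> real"
  assumes infinite_dim: "\<not> (\<exists>B :: 'h set. finite B \<and> span B = UNIV)"
    and C: "C \<in> L_sym" "positive_op C" "trace_class C"
    and gaussian: "is_gaussian \<mu> mbar C"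
    and measurable: "\<Theta> \<in> borel_measurable \<mu>"
    and deriv: "has_gradient_hessian \<Theta> mbar g H"
    and H: "H \<in> L_sym"
    and quad: "\<Theta>quad = quad_approx \<Theta> mbar g H"
  shows "integrable \<mu> \<Theta>quad
    \<and> integrable \<mu> (\<lambda>m. (\<Theta>quad m - prob_space.expectation \<mu> \<Theta>quad)\<^sup>2)
    \<and> trace_class (op_sqrt C o\<^sub>L H o\<^sub>L op_sqrt C)
    \<and> trace_class ((op_sqrt C o\<^sub>L H o\<^sub>L op_sqrt C) o\<^sub>L (op_sqrt C o\<^sub>L H o\<^sub>L op_sqrt C))
    \<and> prob_space.expectation \<mu> \<Theta>quad = \<Theta> mbar + 1/2 * op_trace (op_sqrt C o\<^sub>L H o\<^sub>L op_sqrt C)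
    \<and> prob_space.variance \<mu> \<Theta>quad = g \<bullet> C g + 1/2 * op_trace ((op_sqrt C o\<^sub>L H o\<^sub>L op_sqrt C) o\<^sub>L (op_sqrt C o\<^sub>L H o\<^sub>L op_sqrt C))"
proof -
  interpret hilbert_gaussian \<mu> mbar C
    using gaussian C by unfold_locales
  obtain e :: "nat \<Rightarrow> 'h" where e: "parseval_family UNIV e"
    using parseval_sequence_exists by blast
  have quad': "\<Theta>quad = (\<lambda>x. \<Theta> mbar + g \<bullet> (x - mbar) + 1/2 * (H (x - mbar) \<bullet> (x - mbar)))"
    by (simp add: quad quad_approx_def fun_eq_iff)
  have E: "integrable \<mu> \<Theta>quad"
      "prob_space.expectation \<mu> \<Theta>quad = \<Theta> mbar + 1/2 * op_trace (op_sqrt C o\<^sub>L H o\<^sub>L op_sqrt C)"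
    using expectation_quadratic_polynomial[OF H] by (simp_all add: quad' has_bochner_integral_iff)
  have V: "integrable \<mu> (\<lambda>m. (\<Theta>quad m - prob_space.expectation \<mu> \<Theta>quad)\<^sup>2)"
      "prob_space.variance \<mu> \<Theta>quad
        = C g \<bullet> g + 1/2 * op_trace ((op_sqrt C o\<^sub>L H o\<^sub>L op_sqrt C) o\<^sub>L (op_sqrt C o\<^sub>L H o\<^sub>L op_sqrt C))"
    using variance_quadratic_polynomial[OF H, of "\<Theta> mbar" g] unfolding E(2)
    by (simp_all add: quad' has_bochner_integral_iff)
  show ?thesis
    using E V trace_class_op_sqrt_sandwich[OF C H e]
      trace_class_op_sqrt_sandwich[OF C congruence_sym[OF H] e] op_sqrt_sandwich_square[OF H]
    by (simp add: inner_commute)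
qed

end
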